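(* Suppose that $(X,d,\mu)$ is a metric measure space and $p,s\in\mathcal{P}_b(X)$, $q\in\mathcal{P}(X)$. Assume that at least one of the following conditions holds: (i) $(X,d)$ is totally bounded; (ii) the measure $\mu$ is integrable and $p\in\mathcal{P}^{\log}_{\mu}(X)$. Then we have the compact embeddings $$M^{s(\cdot)}_{p(\cdot),q(\cdot)}(X,d,\mu)\hookrightarrow\hookrightarrow L^{p(\cdot)}(X,\mu),\qquad N^{s(\cdot)}_{p(\cdot),q(\cdot)}(X,d,\mu)\hookrightarrow\hookrightarrow L^{p(\cdot)}(X,\mu).$$
   Context: A metric measure space $(X,d,\mu)$ is a metric space $(X,d)$ with a Borel measure $\mu$ such that $0<\mu(B(x,r))<\infty$ for every open ball $B(x,r)$, $x\in X$, $r\in(0,\infty)$ (in particular $X$ is separable). Exponents: for a measurable function $p$ on a measurable set $E\subseteq X$, $p_E^+=\operatorname{ess\,sup}_E p$, $p_E^-=\operatorname{ess\,inf}_E p$, $p^\pm=p_X^\pm$. $\mathcal{P}(X)$ is the set of measurable $p:X\to(0,\infty]$ with $p^->0$; $\mathcal{P}_b(X)=\mathcal{P}(X)\cap L^\infty(X,\mu)$. Convention: $1/\infty=0$. Lebesgue spaces: for $p\in\mathcal{P}(X)$ let $\rho_{p(\cdot)}(u)=\int_X\varphi_{p(x)}(|u(x)|)\,d\mu(x)$, where $\varphi_p(t)=t^p$ for $p<\infty$, and $\varphi_\infty(t)=0$ for $t\le1$, $\varphi_\infty(t)=\infty$ for $t>1$. $L^{p(\cdot)}(X,\mu)$ is the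 space of measurable $u$ with $\rho_{p(\cdot)}(\lambda u)<\infty$ for some $\lambda>0$, with quasi-norm $\|u\|_{L^{p(\cdot)}}=\inf\{\lambda>0:\rho_{p(\cdot)}(u/\lambda)\le1\}$. $\mathcal{P}^{\log}_\mu(X)$: the set of $p\in\mathcal{P}_b(X)$ such that there is $C\in(0,\infty)$ with $\mu(B)^{1/p_B^+-1/p_B^-}\le C$ for every ball $B\subseteq X$, and there is $p_\infty\in(0,\infty]$ such that $1\in L^{\tau(\cdot)}(X,\mu)$, where $\frac1{\tau(x)}:=\left|\frac1{p(x)}-\frac1{p_\infty}\right|$. The measure $\mu$ is integrable if $\int_X\frac{1}{\mu(B(x,r))}\,d\mu(x)<\infty$ for every $r\in(0,\infty)$. Mixed spaces ($p\in\mathcal{P}_b(X)$, $q\in\mathcal{P}(X)$): for sequences $\{u_k\}_{k\in\mathbb{Z}}$ of measurable functions, $\|\{u_k\}\|_{L^{p(\cdot)}(\ell^{q(\cdot)})}=\big\|\,\|\{u_k(\cdot)\}_k\|_{\ell^{q(\cdot)}}\big\|_{L^{p(\cdot)}}$ (pointwise $\ell^{q(x)}(\mathbb{Z})$ quasi-norm, supremum if $q(x)=\infty$). Let $\rho_{\ell^{q(\cdot)}(L^{p(\cdot)})}(\{u_k\})=\sum_{k\in\mathbb{Z}}\inf\{\lambda_k>0:\rho_{p(\cdot)}(u_k/\lambda_k^{1/q(\cdot)})\le1\}$ (with $\lambda^{1/\infty}=1$) and $\|\{u_k\}\|_{\ell^{q(\cdot)}(L^{p(\cdot)})}=\inf\{m>0:\rho_{\ell^{q(\cdot)}(L^{p(\cdot)})}(\{u_k\}/m)\le1\}$.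 Gradients: let $s\in\mathcal{P}_b(X)$ and $u:X\to\overline{\mathbb{R}}$ be measurable and finite a.e. A sequence $\{g_k\}_{k\in\mathbb{Z}}$ of non-negative measurable functions is a vector $s(\cdot)$-gradient of $u$ (written $\{g_k\}\in\mathbb{D}^{s(\cdot)}(u)$) if there is a $\mu$-null set $N_u$ such that $|u(x)-u(y)|\le d(x,y)^{s(x)}g_k(x)+d(x,y)^{s(y)}g_k(y)$ for all $k\in\mathbb{Z}$ and all $x,y\in X\setminus N_u$ with $2^{-k-1}\le d(x,y)<2^{-k}$. Function spaces: $\|u\|_{\dot M^{s(\cdot)}_{p(\cdot),q(\cdot)}}=\inf_{g\in\mathbb{D}^{s(\cdot)}(u)}\|g\|_{L^{p(\cdot)}(\ell^{q(\cdot)})}$ and $\|u\|_{\dot N^{s(\cdot)}_{p(\cdot),q(\cdot)}}=\inf_{g\in\mathbb{D}^{s(\cdot)}(u)}\|g\|_{\ell^{q(\cdot)}(L^{p(\cdot)})}$. For $A\in\{M,N\}$, $A^{s(\cdot)}_{p(\cdot),q(\cdot)}(X,d,\mu)$ is the space of $u\in L^{p(\cdot)}(X,\mu)$ with $\|u\|_{\dot A^{s(\cdot)}_{p(\cdot),q(\cdot)}}<\infty$, with quasi-norm $\|u\|_{L^{p(\cdot)}}+\|u\|_{\dot A^{s(\cdot)}_{p(\cdot),q(\cdot)}}$. $Y\hookrightarrow\hookrightarrow Z$ (compact embedding) means $Y\subseteq Z$ with continuous inclusion mapping bounded subsets of $Y$ to totally bounded subsets of $Z$. *)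

theory Defs
  imports "HOL-Probability.Essential_Supremum"
begin

definition metric_measure_space :: "'a::metric_space measure \<Rightarrow> bool" where
  "metric_measure_space M \<longleftrightarrow> sets M = sets borel \<and>
     (\<forall>x r. 0 < r \<longrightarrow> 0 < emeasure M (ball x r) \<and> emeasure M (ball x r) < \<infinity>)"

definition integrable_measure :: "'a::metric_space measure \<Rightarrow> bool" where
  "integrable_measure M \<longleftrightarrow> (\<forall>r>0. (\<integral>\<^sup>+x. 1 / emeasure M (ball x r) \<partial>M) < \<infinity>)"

section \<open>Variable exponents\<close>

text \<open>Exponents take values in \<open>(0,\<infinity>]\<close> and are modelled by \<open>ennreal\<close>-valued functions;
  \<open>inverse \<infinity> = 0\<close> there.\<close>

definition essinf :: "'a measure \<Rightarrow> ('a \<Rightarrow> ennreal) \<Rightarrow> ennreal" where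
  "essinf M f = Sup {z. AE x in M. z \<le> f x}"

definition exp_sup :: "'a measure \<Rightarrow> 'a set \<Rightarrow> ('a \<Rightarrow> ennreal) \<Rightarrow> ennreal" where
  "exp_sup M E p = esssup (restrict_space M E) p"

definition exp_inf :: "'a measure \<Rightarrow> 'a set \<Rightarrow> ('a \<Rightarrow> ennreal) \<Rightarrow> ennreal" where
  "exp_inf M E p = essinf (restrict_space M E) p"

definition exponents :: "'a measure \<Rightarrow> ('a \<Rightarrow> ennreal) set" where
  "exponents M = {p \<in> borel_measurable M. (\<forall>x\<in>space M. 0 < p x) \<and> 0 < exp_inf M (space M) p}"

definition bounded_exponents :: "'a measure \<Rightarrow> ('a \<Rightarrow> ennreal) set" where
  "bounded_exponents M = {p \<in> exponents M. exp_sup M (space M) p < \<infinity>}"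

section \<open>Variable exponent Lebesgue spaces\<close>

text \<open>Only used for \<open>r > 0\<close>.\<close>

definition ennpowr :: "ennreal \<Rightarrow> real \<Rightarrow> ennreal" where
  "ennpowr t r = (if t = \<infinity> then \<infinity> else ennreal (enn2real t powr r))"

definition phi :: "ennreal \<Rightarrow> ennreal \<Rightarrow> ennreal" where
  "phi p t = (if p = \<infinity> then (if t \<le> 1 then 0 else \<infinity>) else ennpowr t (enn2real p))"

text \<open>Modulars and quasi-norms depend only on absolute values, so they are defined on functions
  with values in \<open>[0,\<infinity>]\<close> and applied to extended real functions \<open>u\<close> through \<open>|u|\<close>. An infimum
  over an empty set of admissible constants is \<open>\<infinity>\<close>.\<close>

definition modular :: "'a measure \<Rightarrow> ('a \<Rightarrow> ennreal) \<Rightarrow> ('a \<Rightarrow> ennreal) \<Rightarrow> ennreal" where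
  "modular M p f = (\<integral>\<^sup>+x. phi (p x) (f x) \<partial>M)"

definition Lp_norm :: "'a measure \<Rightarrow> ('a \<Rightarrow> ennreal) \<Rightarrow> ('a \<Rightarrow> ennreal) \<Rightarrow> ennreal" where
  "Lp_norm M p f = Inf {ennreal l | l. 0 < l \<and> modular M p (\<lambda>x. f x / ennreal l) \<le> 1}"

definition eabs :: "('a \<Rightarrow> ereal) \<Rightarrow> 'a \<Rightarrow> ennreal" where
  "eabs u x = e2ennreal \<bar>u x\<bar>"

definition Lp_space :: "'a measure \<Rightarrow> ('a \<Rightarrow> ennreal) \<Rightarrow> ('a \<Rightarrow> ereal) set" where
  "Lp_space M p = {u \<in> borel_measurable M.
     \<exists>l>0. modular M p (\<lambda>x. ennreal l * eabs u x) < \<infinity>}"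

text \<open>The exponent \<open>\<tau>\<close> is determined by \<open>1/\<tau> = |1/p - 1/p\<^sub>\<infinity>|\<close>; it equals \<open>\<infinity>\<close> where the
  right-hand side vanishes.\<close>

definition log_exponents :: "'a::metric_space measure \<Rightarrow> ('a \<Rightarrow> ennreal) set" where
  "log_exponents M = {p \<in> bounded_exponents M.
     (\<exists>C::real>0. \<forall>x r. 0 < r \<longrightarrow>
        measure M (ball x r) powr (enn2real (inverse (exp_sup M (ball x r) p))
                                 - enn2real (inverse (exp_inf M (ball x r) p))) \<le> C) \<and>
     (\<exists>p_inf>0. (\<lambda>_. 1) \<in> Lp_space M (\<lambda>x.
        inverse (ennreal \<bar>enn2real (inverse (p x)) - enn2real (inverse p_inf)\<bar>)))}"

section \<open>Mixed spaces\<close>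

definition ellq_norm :: "ennreal \<Rightarrow> (int \<Rightarrow> ennreal) \<Rightarrow> ennreal" where
  "ellq_norm q a = (if q = \<infinity> then (SUP k. a k)
     else ennpowr (\<Sum>\<^sub>\<infinity>k. ennpowr (a k) (enn2real q)) (1 / enn2real q))"

definition Lp_ellq_norm ::
  "'a measure \<Rightarrow> ('a \<Rightarrow> ennreal) \<Rightarrow> ('a \<Rightarrow> ennreal) \<Rightarrow> (int \<Rightarrow> 'a \<Rightarrow> ennreal) \<Rightarrow> ennreal" where
  "Lp_ellq_norm M p q g = Lp_norm M p (\<lambda>x. ellq_norm (q x) (\<lambda>k. g k x))"

definition ellq_Lp_modular ::
  "'a measure \<Rightarrow> ('a \<Rightarrow> ennreal) \<Rightarrow> ('a \<Rightarrow> ennreal) \<Rightarrow> (int \<Rightarrow> 'a \<Rightarrow> ennreal) \<Rightarrow> ennreal" where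
  "ellq_Lp_modular M p q g = (\<Sum>\<^sub>\<infinity>k. Inf {ennreal l | l. 0 < l \<and>
     modular M p (\<lambda>x. g k x / ennreal (l powr enn2real (inverse (q x)))) \<le> 1})"

definition ellq_Lp_norm ::
  "'a measure \<Rightarrow> ('a \<Rightarrow> ennreal) \<Rightarrow> ('a \<Rightarrow> ennreal) \<Rightarrow> (int \<Rightarrow> 'a \<Rightarrow> ennreal) \<Rightarrow> ennreal" where
  "ellq_Lp_norm M p q g = Inf {ennreal m | m. 0 < m \<and>
     ellq_Lp_modular M p q (\<lambda>k x. g k x / ennreal m) \<le> 1}"

section \<open>Vector gradients and the function spaces\<close>

text \<open>A bounded exponent \<open>s\<close> may be infinite on a null set. The value of \<open>enn2real (s x)\<close> at such
  points is irrelevant, since the exceptional set \<open>N\<close> can be enlarged by a null set.\<close>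

definition gradients ::
  "'a::metric_space measure \<Rightarrow> ('a \<Rightarrow> ennreal) \<Rightarrow> ('a \<Rightarrow> ereal) \<Rightarrow> (int \<Rightarrow> 'a \<Rightarrow> ennreal) set" where
  "gradients M s u = {g. (\<forall>k. g k \<in> borel_measurable M) \<and>
     (\<exists>N \<in> null_sets M. \<forall>k. \<forall>x\<in>-N. \<forall>y\<in>-N.
        2 powr (- real_of_int k - 1) \<le> dist x y \<and> dist x y < 2 powr (- real_of_int k) \<longrightarrow>
        e2ennreal \<bar>u x - u y\<bar> \<le>
          ennreal (dist x y powr enn2real (s x)) * g k x +
          ennreal (dist x y powr enn2real (s y)) * g k y)}"

definition M_seminorm :: "'a::metric_space measure \<Rightarrow> ('a \<Rightarrow> ennreal) \<Rightarrow> ('a \<Rightarrow> ennreal) \<Rightarrow>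
    ('a \<Rightarrow> ennreal) \<Rightarrow> ('a \<Rightarrow> ereal) \<Rightarrow> ennreal" where
  "M_seminorm M s p q u = (INF g \<in> gradients M s u. Lp_ellq_norm M p q g)"

definition N_seminorm :: "'a::metric_space measure \<Rightarrow> ('a \<Rightarrow> ennreal) \<Rightarrow> ('a \<Rightarrow> ennreal) \<Rightarrow>
    ('a \<Rightarrow> ennreal) \<Rightarrow> ('a \<Rightarrow> ereal) \<Rightarrow> ennreal" where
  "N_seminorm M s p q u = (INF g \<in> gradients M s u. ellq_Lp_norm M p q g)"

text \<open>A quasi-normed function space is a set of extended real functions (finite almost everywhere)
  together with a quasi-norm. Functions are not identified modulo null sets: the quasi-norms
  depend only on the almost-everywhere class, and so do all notions below. In particular the value
  of a pointwise difference on the null set where both functions are infinite is irrelevant.\<close>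

type_synonym 'a qnspace = "('a \<Rightarrow> ereal) set \<times> (('a \<Rightarrow> ereal) \<Rightarrow> ennreal)"

definition L_qnspace :: "'a measure \<Rightarrow> ('a \<Rightarrow> ennreal) \<Rightarrow> 'a qnspace" where
  "L_qnspace M p = (Lp_space M p, \<lambda>u. Lp_norm M p (eabs u))"

definition M_qnspace :: "'a::metric_space measure \<Rightarrow> ('a \<Rightarrow> ennreal) \<Rightarrow> ('a \<Rightarrow> ennreal) \<Rightarrow>
    ('a \<Rightarrow> ennreal) \<Rightarrow> 'a qnspace" where
  "M_qnspace M s p q = ({u \<in> Lp_space M p. M_seminorm M s p q u < \<infinity>},
     \<lambda>u. Lp_norm M p (eabs u) + M_seminorm M s p q u)"

definition N_qnspace :: "'a::metric_space measure \<Rightarrow> ('a \<Rightarrow> ennreal) \<Rightarrow> ('a \<Rightarrow> ennreal) \<Rightarrow>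
    ('a \<Rightarrow> ennreal) \<Rightarrow> 'a qnspace" where
  "N_qnspace M s p q = ({u \<in> Lp_space M p. N_seminorm M s p q u < \<infinity>},
     \<lambda>u. Lp_norm M p (eabs u) + N_seminorm M s p q u)"

section \<open>Compact embeddings\<close>

definition qn_bounded :: "'a qnspace \<Rightarrow> ('a \<Rightarrow> ereal) set \<Rightarrow> bool" where
  "qn_bounded Y S \<longleftrightarrow> S \<subseteq> fst Y \<and> (\<exists>C::real. \<forall>u\<in>S. snd Y u \<le> ennreal C)"

definition qn_totally_bounded :: "'a qnspace \<Rightarrow> ('a \<Rightarrow> ereal) set \<Rightarrow> bool" where
  "qn_totally_bounded Z S \<longleftrightarrow> S \<subseteq> fst Z \<and>
     (\<forall>e::real>0. \<exists>F. finite F \<and> F \<subseteq> fst Z \<and>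
        (\<forall>u\<in>S. \<exists>v\<in>F. snd Z (\<lambda>x. u x - v x) < ennreal e))"

definition qn_continuous_inclusion :: "'a qnspace \<Rightarrow> 'a qnspace \<Rightarrow> bool" where
  "qn_continuous_inclusion Y Z \<longleftrightarrow> fst Y \<subseteq> fst Z \<and>
     (\<forall>u\<in>fst Y. \<forall>e::real>0. \<exists>d::real>0. \<forall>v\<in>fst Y.
        snd Y (\<lambda>x. v x - u x) < ennreal d \<longrightarrow> snd Z (\<lambda>x. v x - u x) < ennreal e)"

definition compactly_embedded :: "'a qnspace \<Rightarrow> 'a qnspace \<Rightarrow> bool"
    (infix \<open>\<hookrightarrow>\<hookrightarrow>\<close> 50) where
  "Y \<hookrightarrow>\<hookrightarrow> Z \<longleftrightarrow> qn_continuous_inclusion Y Z \<and>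
     (\<forall>S. qn_bounded Y S \<longrightarrow> qn_totally_bounded Z S)"

end

theory Submission
  imports Defs
begin

text \<open>
  Of a gradient only two things are used: each component \<open>g k\<close> is bounded in \<open>L\<^sup>p\<close> by a constant
  common to the whole bounded family, and the component \<open>g k\<close> controls the difference of
  two values at distance about \<open>2\<^sup>-\<^sup>k\<close> with a factor that decays geometrically in \<open>k\<close>. Both scales of
  spaces provide this (\<open>M_seminorm_gradient\<close>, \<open>N_seminorm_gradient\<close>), and from there on they are
  treated alike. The exponents \<open>p\<close> and \<open>s\<close> agree almost everywhere with real functions between two
  positive constants, so the quasi-norm of \<open>L\<^sup>p\<close> is small exactly when the modular is, and everything
  reduces to a family of real functions and the modular \<open>rmodular\<close>.

  The compactness rests on two properties of such a family. It has small oscillation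
  (\<open>equi_oscillating\<close>): at small scales \<open>|w x - w y| \<le> G x + G y\<close> with \<open>G\<close> of small modular; this
  follows from the gradients by summing over all fine scales (\<open>equi_oscillatingI\<close>). And it is dominated
  (\<open>equi_dominated\<close>): up to a remainder with small integral, the function \<open>|w|\<^sup>p\<close> lies below an
  integrable function common to the whole family. Domination yields smallness outside a set of finite
  measure and uniform integrability on it; there a step function with values in a finite set
  approximates \<open>w\<close>, because the oscillation is small outside a set of small measure
  (\<open>totally_bounded_modular\<close>). Oscillation and domination together thus replace a Kolmogorov-Riesz
  criterion.

  Domination is where the two alternative hypotheses come in. Every ball of the right radius contains a
  point \<open>y\<close> at which \<open>|w y|\<^sup>p\<close> and \<open>(G y)\<^sup>p\<close>, with the exponent at \<open>y\<close>, are at most a constant divided by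
  the measure of the ball (\<open>point_with_small_values\<close>), and \<open>|w x| \<le> G x + |w y| + G y\<close> for \<open>x\<close> nearby.
  If finitely many balls suffice, the last two terms are bounded by a constant, and the measure is finite
  (\<open>equi_dominated_totally_bounded\<close>). Otherwise they must be raised to the power at \<open>x\<close> instead of \<open>y\<close>.
  For balls of measure at most \<open>1\<close> the local log-Hoelder condition allows this; for larger balls the
  values are small and the decay condition at infinity allows it (\<open>change_exponent\<close>,
  \<open>log_exponents_decay\<close>). The dominating function is then a multiple of the reciprocal of the
  measure of the ball, which is integrable because the measure is, plus an integrable function that the
  decay condition contributes (\<open>equi_dominated_integrable\<close>).
\<close>

section \<open>Powers with exponents in a compact interval\<close>

lemma powr_le_one_exponent:
  fixes x a b :: real
  assumes "0 \<le> x" "x \<le> 1" "a \<le> b"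
  shows "x powr b \<le> x powr a"
  using assms by (cases "x = 0") (auto intro: powr_mono')

lemma powr_le_of_ge_one:
  fixes x y r \<beta> :: real
  assumes "0 \<le> x" "x \<le> y" "1 \<le> y" "0 \<le> r" "r \<le> \<beta>"
  shows "x powr r \<le> y powr \<beta>"
proof -
  have "x powr r \<le> y powr r" using assms by (intro powr_mono2) auto
  also have "\<dots> \<le> y powr \<beta>" using assms by (intro powr_mono) auto
  finally show ?thesis .
qed

lemma powr_le_sum3:
  fixes a b c x r \<beta> :: real
  assumes "0 \<le> a" "0 \<le> b" "0 \<le> c" "0 \<le> x" "x \<le> a + b + c" "0 < r" "r \<le> \<beta>"
  shows "x powr r \<le> 3 powr \<beta> * (a powr r + b powr r + c powr r)"
proof -
  define m where "m = max a (max b c)"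
  have m: "x \<le> 3 * m" "0 \<le> m" using assms by (auto simp: m_def)
  have "x powr r \<le> (3 * m) powr r" using assms m by (intro powr_mono2) auto
  also have "\<dots> = 3 powr r * m powr r" using m by (simp add: powr_mult)
  also have "\<dots> \<le> 3 powr \<beta> * m powr r" using assms by (intro mult_right_mono powr_mono) auto
  also have "\<dots> \<le> 3 powr \<beta> * (a powr r + b powr r + c powr r)"
    by (intro mult_left_mono) (auto simp: m_def max_def)
  finally show ?thesis .
qed

lemma le_powr_inverse:
  fixes z c r \<alpha> :: real
  assumes "0 \<le> z" "z powr r \<le> c" "1 \<le> c" "0 < \<alpha>" "\<alpha> \<le> r"
  shows "z \<le> c powr (1 / \<alpha>)"
proof -
  have "z = (z powr r) powr (1 / r)" using assms by (simp add: powr_powr)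
  also have "\<dots> \<le> c powr (1 / r)" using assms by (intro powr_mono2) auto
  also have "\<dots> \<le> c powr (1 / \<alpha>)" using assms by (intro powr_mono) (auto simp: frac_le)
  finally show ?thesis .
qed

section \<open>Metric measure spaces\<close>

locale metric_measure =
  fixes M :: "'a::metric_space measure"
  assumes sets_eq [measurable_cong]: "sets M = sets borel"
    and ball_pos: "0 < d \<Longrightarrow> 0 < emeasure M (ball x d)"
    and ball_fin: "0 < d \<Longrightarrow> emeasure M (ball x d) < \<infinity>"
begin

lemma space_eq [simp]: "space M = UNIV"
  using sets_eq_imp_space_eq[OF sets_eq] by simp

lemma open_meas: "open A \<Longrightarrow> A \<in> sets M"
  by (simp add: sets_eq)

lemma ball_meas [measurable, simp]: "ball x d \<in> sets M"
  by (simp add: open_meas)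

lemma compl_meas: "A \<in> sets M \<Longrightarrow> - A \<in> sets M"
  using sets.compl_sets[of A M] by (simp add: Compl_eq_Diff_UNIV)

lemma AE_null_setE:
  assumes "AE x in M. P x"
  obtains N where "N \<in> null_sets M" "\<And>x. x \<notin> N \<Longrightarrow> P x"
proof -
  obtain N where N: "N \<in> null_sets M" "{x \<in> space M. \<not> P x} \<subseteq> N"
    using assms unfolding eventually_ae_filter by blast
  then show ?thesis by (intro that[of N]) auto
qed

lemma ball_fin': "emeasure M (ball x d) < \<infinity>"
  using ball_fin[of d x] by (cases "0 < d") (auto simp: ball_empty)

lemma ball_ne_top [simp]: "emeasure M (ball x d) \<noteq> top"
  using ball_fin'[of x d] by auto

lemma maximal_separated_set:
  fixes d :: real
  shows "\<exists>A :: 'a set. (\<forall>x\<in>A. \<forall>y\<in>A. x \<noteq> y \<longrightarrow> d \<le> dist x y) \<and> (\<forall>x. \<exists>a\<in>A. dist a x < d \<or> a = x)"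
proof -
  define \<A> where "\<A> = {A :: 'a set. \<forall>x\<in>A. \<forall>y\<in>A. x \<noteq> y \<longrightarrow> d \<le> dist x y}"
  have "\<exists>A\<in>\<A>. \<forall>X\<in>\<A>. A \<subseteq> X \<longrightarrow> X = A"
  proof (rule subset_Zorn')
    fix C assume C: "subset.chain \<A> C"
    show "\<Union>C \<in> \<A>" unfolding \<A>_def
    proof safe
      fix x y X Y assume h: "x \<in> X" "X \<in> C" "y \<in> Y" "Y \<in> C" "x \<noteq> y"
      then have "X \<subseteq> Y \<or> Y \<subseteq> X" using C by (auto simp: subset_chain_def)
      moreover have "X \<in> \<A>" "Y \<in> \<A>" using C h by (auto simp: subset_chain_def)
      ultimately show "d \<le> dist x y" using h unfolding \<A>_def by blast
    qed
  qed
  then obtain A where A: "A \<in> \<A>" and max: "\<And>X. X \<in> \<A> \<Longrightarrow> A \<subseteq> X \<Longrightarrow> X = A" by blast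
  have "\<exists>a\<in>A. dist a x < d \<or> a = x" for x
  proof (rule ccontr)
    assume n: "\<not> ?thesis"
    then have "d \<le> dist a x \<and> d \<le> dist x a" if "a \<in> A" for a
      using that by (auto simp: dist_commute not_less)
    then have "insert x A \<in> \<A>" using A by (simp add: \<A>_def)
    from max[OF this] have "x \<in> A" by blast
    with n show False by blast
  qed
  then show ?thesis using A by (intro exI[of _ A]) (simp add: \<A>_def)
qed

text \<open>Balls around the points of a maximal separated set are disjoint, and only countably many
  disjoint sets of positive measure fit into a ball of finite measure. This is the form in which
  separability of the space is used.\<close>

lemma countable_ball_cover:
  assumes d: "0 < d"
  shows "\<exists>a :: nat \<Rightarrow> 'a. (\<Union>i. ball (a i) d) = UNIV"
proof -
  from maximal_separated_set[of d] obtain A :: "'a set"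
    where A: "\<forall>x\<in>A. \<forall>y\<in>A. x \<noteq> y \<longrightarrow> d \<le> dist x y"
      "\<forall>x. \<exists>a\<in>A. dist a x < d \<or> a = x"
    by (elim exE conjE)
  note sep = A(1)[rule_format] and net = A(2)[rule_format]
  define x0 :: 'a where "x0 = undefined"
  define m where "m a = measure M (ball a (d / 2))" for a
  have mpos: "m a \<noteq> 0" for a
  proof -
    have "emeasure M (ball a (d / 2)) \<noteq> 0" "emeasure M (ball a (d / 2)) \<noteq> top"
      using ball_pos[of "d/2" a] d by auto
    then show ?thesis by (simp add: m_def measure_def enn2real_eq_0_iff)
  qed
  have "countable (A \<inter> ball x0 (real n))" for n
  proof -
    have "m summable_on (A \<inter> ball x0 (real n))"
    proof (rule nonneg_bdd_above_summable_on)
      show "bdd_above (sum m ` {F. F \<subseteq> A \<inter> ball x0 (real n) \<and> finite F})"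
      proof (rule bdd_aboveI2)
        fix F assume F: "F \<in> {F. F \<subseteq> A \<inter> ball x0 (real n) \<and> finite F}"
        have "disjoint_family_on (\<lambda>a. ball a (d / 2)) F"
          unfolding disjoint_family_on_def
        proof safe
          fix a b x assume h: "a \<in> F" "b \<in> F" "a \<noteq> b" "x \<in> ball a (d/2)" "x \<in> ball b (d/2)"
          then have "d \<le> dist a b" using sep F by auto
          moreover have "dist a b \<le> dist a x + dist b x" by (rule dist_triangle2)
          ultimately show "x \<in> {}" using h by auto
        qed
        then have "sum m F = measure M (\<Union>a\<in>F. ball a (d / 2))"
          unfolding m_def using F by (subst measure_finite_Union) auto
        also have "\<dots> \<le> measure M (ball x0 (real n + d))"
        proof (rule measure_mono_fmeasurable)
          show "(\<Union>a\<in>F. ball a (d / 2)) \<subseteq> ball x0 (real n + d)"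
          proof safe
            fix a x assume h: "a \<in> F" "x \<in> ball a (d / 2)"
            then have "a \<in> ball x0 (real n)" using F by auto
            moreover have "dist x0 x \<le> dist x0 a + dist a x" by (rule dist_triangle)
            ultimately show "x \<in> ball x0 (real n + d)" using h d by auto
          qed
          show "ball x0 (real n + d) \<in> fmeasurable M"
            by (intro fmeasurableI) (simp_all add: less_top[symmetric])
        qed (auto intro!: open_meas)
        finally show "sum m F \<le> measure M (ball x0 (real n + d))" .
      qed
    qed (simp add: m_def)
    from summable_countable_real[OF this] show ?thesis by (simp only: mpos simp_thms Collect_mem_eq)
  qed
  then have "countable (\<Union>n. A \<inter> ball x0 (real n))" by blast
  moreover have "(\<Union>n. A \<inter> ball x0 (real n)) = A"
  proof -
    have "\<exists>n. dist x0 a < real n" for a using reals_Archimedean2 by blast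
    then show ?thesis by auto
  qed
  ultimately have cA: "countable A" by simp
  have ne: "A \<noteq> {}" using net[of x0] by blast
  have "x \<in> (\<Union>i. ball (from_nat_into A i) d)" for x
  proof -
    obtain a where a: "a \<in> A" "dist a x < d \<or> a = x" using net by blast
    then obtain i where "a = from_nat_into A i"
      using from_nat_into_surj[OF cA, of a] by blast
    then have "x \<in> ball (from_nat_into A i) d" using a d by auto
    then show ?thesis by blast
  qed
  then have "(\<Union>i. ball (from_nat_into A i) d) = UNIV" by blast
  then show ?thesis by (intro exI[of _ "from_nat_into A"])
qed

text \<open>The index is required to be positive because it will also serve as an upper bound that is
  at least \<open>1\<close>.\<close>

lemma integral_outside_exhaustion:
  assumes F [measurable]: "F \<in> borel_measurable M" and fin: "(\<integral>\<^sup>+x. F x \<partial>M) < \<infinity>"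
    and D: "\<And>n. D n \<in> sets M" "incseq D" "(\<Union>n. D n) = UNIV" and e: "0 < (e :: real)"
  shows "\<exists>n::nat. n > 0 \<and> (\<integral>\<^sup>+x. F x * indicator (- D n) x \<partial>M) \<le> ennreal e"
proof -
  let ?N = "density M F"
  have 1: "- D n \<in> sets M" for n using D(1) by (rule compl_meas)
  have em: "emeasure ?N (- D n) = (\<integral>\<^sup>+x. F x * indicator (- D n) x \<partial>M)" for n
    using 1[of n] by (simp add: emeasure_density)
  have "emeasure ?N (- D n) \<le> (\<integral>\<^sup>+x. F x \<partial>M)" for n
    unfolding em by (intro nn_integral_mono) (auto simp: indicator_def)
  then have f: "emeasure ?N (- D n) \<noteq> \<infinity>" for n using fin by (metis le_less_trans less_irrefl)
  have "(\<lambda>n. emeasure ?N (- D n)) \<longlonglongrightarrow> emeasure ?N (\<Inter>n. - D n)"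
  proof (rule Lim_emeasure_decseq)
    show "range (\<lambda>n. - D n) \<subseteq> sets ?N" using 1 by (simp add: image_subset_iff)
    show "decseq (\<lambda>n. - D n)" unfolding decseq_def
      using incseqD[OF D(2)] by (simp only: Compl_subset_Compl_iff) blast
    show "emeasure ?N (- D i) \<noteq> \<infinity>" for i by (rule f)
  qed
  also have "(\<Inter>n. - D n) = {}" using D(3) by auto
  finally have "(\<lambda>n. emeasure ?N (- D n)) \<longlonglongrightarrow> 0" by simp
  then have "eventually (\<lambda>n. emeasure ?N (- D n) < ennreal e) sequentially"
    using e by (intro order_tendstoD) auto
  then have "eventually (\<lambda>n. emeasure ?N (- D n) < ennreal e \<and> n > 0) sequentially"
    using eventually_gt_at_top[of 0] by eventually_elim auto
  then obtain n where "emeasure ?N (- D n) < ennreal e" "n > 0"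
    using eventually_happens'[OF sequentially_bot] by blast
  then have "n > 0 \<and> (\<integral>\<^sup>+x. F x * indicator (- D n) x \<partial>M) \<le> ennreal e"
    unfolding em by simp
  then show ?thesis by blast
qed

end

section \<open>Total boundedness in the modular sense\<close>

locale variable_exponent = metric_measure M for M :: "'a::metric_space measure" +
  fixes r :: "'a \<Rightarrow> real" and \<alpha> \<beta> :: real
  assumes r_meas [measurable]: "r \<in> borel_measurable M"
    and \<alpha>_pos: "0 < \<alpha>" and r_lower: "\<alpha> \<le> r x" and r_upper: "r x \<le> \<beta>"
begin

lemma r_pos: "0 < r x" using \<alpha>_pos r_lower[of x] by linarith
lemma \<alpha>_le_\<beta>: "\<alpha> \<le> \<beta>" using r_lower[of undefined] r_upper[of undefined] by linarith
lemma \<beta>_pos: "0 < \<beta>" using \<alpha>_pos \<alpha>_le_\<beta> by linarith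

definition rmodular :: "('a \<Rightarrow> real) \<Rightarrow> ennreal" where
  "rmodular f = (\<integral>\<^sup>+x. ennreal (\<bar>f x\<bar> powr r x) \<partial>M)"

definition equi_oscillating :: "('a \<Rightarrow> real) set \<Rightarrow> bool" where
  "equi_oscillating W \<longleftrightarrow> (\<forall>e>0. \<exists>d>0. \<forall>w\<in>W. \<exists>G\<in>borel_measurable M. (\<forall>x. 0 \<le> G x) \<and>
     rmodular G \<le> ennreal e \<and>
     (\<exists>N\<in>null_sets M. \<forall>x\<in>-N. \<forall>y\<in>-N. dist x y < d \<longrightarrow> \<bar>w x - w y\<bar> \<le> G x + G y))"

definition equi_dominated :: "('a \<Rightarrow> real) set \<Rightarrow> bool" where
  "equi_dominated W \<longleftrightarrow> (\<forall>e>0. \<exists>F\<in>borel_measurable M. (\<forall>x. 0 \<le> F x) \<and>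
     (\<integral>\<^sup>+x. ennreal (F x) \<partial>M) < \<infinity> \<and>
     (\<forall>w\<in>W. \<exists>G\<in>borel_measurable M. (\<forall>x. 0 \<le> G x) \<and> (\<integral>\<^sup>+x. ennreal (G x) \<partial>M) \<le> ennreal e \<and>
       (AE x in M. \<bar>w x\<bar> powr r x \<le> G x + F x)))"

lemma superlevel_measure_le:
  assumes G [measurable]: "G \<in> borel_measurable M" and G0: "\<And>x. 0 \<le> G x"
    and int: "rmodular G \<le> ennreal e" and t: "0 < t" "t \<le> 1"
  shows "ennreal (t powr \<beta>) * emeasure M {x. t < G x} \<le> ennreal e"
proof -
  have [measurable]: "{x. t < G x} \<in> sets M"
    using measurable_sets[OF G, of "{t<..}"] by (simp add: vimage_def)
  have "ennreal (t powr \<beta>) * indicator {x. t < G x} x \<le> ennreal (\<bar>G x\<bar> powr r x)" for x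
  proof (cases "t < G x")
    case True
    have "t powr \<beta> \<le> t powr r x" using t r_upper by (intro powr_le_one_exponent) auto
    also have "\<dots> \<le> \<bar>G x\<bar> powr r x" using True t r_pos[of x] by (intro powr_mono2) auto
    finally show ?thesis using True by (simp add: ennreal_leI)
  qed auto
  then have "(\<integral>\<^sup>+x. ennreal (t powr \<beta>) * indicator {x. t < G x} x \<partial>M) \<le> rmodular G"
    unfolding rmodular_def by (intro nn_integral_mono) auto
  then show ?thesis using int by (simp add: nn_integral_cmult_indicator)
qed

text \<open>Outside a set \<open>D'\<close> which carries all but a small part of the integral of the dominating
  function \<open>F\<close> the members of the family are negligible. On \<open>D'\<close>, where \<open>F\<close> is at most \<open>K\<close> and
  which finitely many small balls cover, a function is compared on each cell with its value at a
  point of the cell where neither the oscillation function \<open>G2\<close> nor the remainder \<open>G\<close> is large.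
  The exponent at that point is forgotten at once: all that is kept is that the value is at
  most \<open>K2\<close>. The order of the choices matters: \<open>F\<close> determines \<open>K\<close>, and only then is the scale chosen
  at which the oscillation is small compared with \<open>K\<close>.\<close>

lemma totally_bounded_modular:
  assumes W: "W \<subseteq> borel_measurable M" and osc: "equi_oscillating W" and dom: "equi_dominated W"
    and e: "0 < (e::real)"
  shows "\<exists>V. finite V \<and> V \<subseteq> borel_measurable M \<and> (\<forall>v\<in>V. rmodular v < \<infinity>) \<and>
    (\<forall>w\<in>W. \<exists>v\<in>V. rmodular (\<lambda>x. w x - v x) \<le> ennreal e)"
proof -
  define C where "C = 3 powr \<beta>"
  have C: "1 \<le> C" unfolding C_def using \<beta>_pos by (intro ge_one_powr_ge_zero) auto
  (* The total error will be at most C times six contributions of size \<eta>. *)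
  define \<eta> where "\<eta> = e / (6 * C)"
  have \<eta>: "0 < \<eta>" using e C by (simp add: \<eta>_def)
  obtain F where F [measurable]: "F \<in> borel_measurable M" and F0: "\<And>x. 0 \<le> F x"
    and Fint: "(\<integral>\<^sup>+x. ennreal (F x) \<partial>M) < \<infinity>"
    and Fdom: "\<And>w. w \<in> W \<Longrightarrow> \<exists>G\<in>borel_measurable M. (\<forall>x. 0 \<le> G x) \<and>
       (\<integral>\<^sup>+x. ennreal (G x) \<partial>M) \<le> ennreal \<eta> \<and> (AE x in M. \<bar>w x\<bar> powr r x \<le> G x + F x)"
    using dom \<eta> unfolding equi_dominated_def by meson
  define x0 :: 'a where "x0 = undefined"
  define Dn where "Dn n = ball x0 (real n) \<inter> {x. F x \<le> real n}" for n
  have Dn_meas: "Dn n \<in> sets M" for n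
  proof -
    have "F -` {..real n} \<inter> space M \<in> sets M" by (rule measurable_sets[OF F]) simp
    moreover have "F -` {..real n} \<inter> space M = {x. F x \<le> real n}" by auto
    ultimately show ?thesis unfolding Dn_def by (intro sets.Int) (simp_all add: open_meas)
  qed
  have "incseq Dn" unfolding Dn_def by (intro monoI) auto
  moreover have "(\<Union>n. Dn n) = UNIV"
  proof -
    have "\<exists>n. x \<in> Dn n" for x
    proof -
      obtain n where "max (dist x0 x) (F x) < real n" using reals_Archimedean2 by blast
      then show ?thesis by (intro exI[of _ n]) (auto simp: Dn_def)
    qed
    then show ?thesis by auto
  qed
  ultimately obtain n0 :: nat where n0: "n0 > 0"
    and FD: "(\<integral>\<^sup>+x. ennreal (F x) * indicator (- Dn n0) x \<partial>M) \<le> ennreal \<eta>"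
    using integral_outside_exhaustion[of "\<lambda>x. ennreal (F x)" Dn \<eta>] Fint Dn_meas \<eta> by auto
  define K where "K = real n0"
  have K: "1 \<le> K" using n0 by (simp add: K_def)
  define D where "D = Dn n0"
  have D_meas [measurable]: "D \<in> sets M" using Dn_meas by (simp add: D_def)
  have FK: "F x \<le> K" if "x \<in> D" for x using that by (simp add: D_def Dn_def K_def)
  have Dfin: "emeasure M D \<noteq> top"
  proof -
    have "emeasure M D \<le> emeasure M (ball x0 K)"
      by (intro emeasure_mono) (auto simp: D_def Dn_def K_def open_meas)
    then show ?thesis using ball_fin'[of x0 K] by auto
  qed
  define md where "md = measure M D"
  have md: "emeasure M D = ennreal md" "0 \<le> md"
    using Dfin by (simp_all add: md_def emeasure_eq_ennreal_measure)
  define K2 where "K2 = (2 * K) powr (1 / \<alpha>)"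
  have K2: "1 \<le> K2" unfolding K2_def using K \<alpha>_pos by (intro ge_one_powr_ge_zero) auto
  (* Off the exceptional set the error will be at most 3 * t, which must be at most 1 so that
     the worst exponent is \<alpha>, and small against the measure of D. *)
  define t where "t = min 1 ((\<eta> / (md + 1)) powr (1 / \<alpha>)) / 3"
  have t: "0 < t" "3 * t \<le> 1" "t \<le> 1" using \<eta> md by (auto simp: t_def)
  have t\<eta>: "(3 * t) powr \<alpha> * md \<le> \<eta>"
  proof -
    have "(3 * t) powr \<alpha> \<le> ((\<eta> / (md + 1)) powr (1 / \<alpha>)) powr \<alpha>"
      using \<eta> md \<alpha>_pos t(1) by (intro powr_mono2) (auto simp: t_def)
    also have "\<dots> = \<eta> / (md + 1)" using \<eta> md \<alpha>_pos by (simp add: powr_powr)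
    finally have "(3 * t) powr \<alpha> * md \<le> \<eta> / (md + 1) * md" using md by (intro mult_right_mono) auto
    also have "\<dots> \<le> \<eta>" using \<eta> md by (simp add: field_simps)
    finally show ?thesis .
  qed
  (* B bounds the error on the exceptional set {t < G2}, apart from G; by Chebyshev's inequality
     the choice of \<epsilon> makes B times the measure of this set at most \<eta>. *)
  define B where "B = K + K2 powr \<beta>"
  have B: "0 < B" using K by (simp add: B_def add_pos_nonneg)
  define \<epsilon> where "\<epsilon> = \<eta> * t powr \<beta> / B"
  have \<epsilon>: "0 < \<epsilon>" using \<eta> t B by (simp add: \<epsilon>_def)
  from osc[unfolded equi_oscillating_def, rule_format, OF \<epsilon>] obtain d where d: "0 < d"
    and Wosc: "\<forall>w\<in>W. \<exists>G\<in>borel_measurable M. (\<forall>x. 0 \<le> G x) \<and> rmodular G \<le> ennreal \<epsilon> \<and>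
     (\<exists>N\<in>null_sets M. \<forall>x\<in>-N. \<forall>y\<in>-N. dist x y < d \<longrightarrow> \<bar>w x - w y\<bar> \<le> G x + G y)"
    by (elim exE conjE)
  obtain a :: "nat \<Rightarrow> 'a" where a: "(\<Union>i. ball (a i) (d/2)) = UNIV"
    using countable_ball_cover[of "d/2"] d by auto
  define U where "U n = (\<Union>i<n. ball (a i) (d/2))" for n
  have Uopen: "open (U n)" for n unfolding U_def by auto
  have "incseq U" unfolding U_def by (intro monoI) force
  moreover have "(\<Union>n. U n) = UNIV"
  proof -
    have "x \<in> (\<Union>n. U n)" for x
    proof -
      obtain i where "x \<in> ball (a i) (d/2)" using a by blast
      then have "x \<in> U (Suc i)" unfolding U_def by blast
      then show ?thesis by blast
    qed
    then show ?thesis by auto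
  qed
  moreover have "(\<integral>\<^sup>+x. ennreal (F x) * indicator D x \<partial>M) < \<infinity>"
  proof -
    have "(\<integral>\<^sup>+x. ennreal (F x) * indicator D x \<partial>M) \<le> (\<integral>\<^sup>+x. ennreal (F x) \<partial>M)"
      by (intro nn_integral_mono) (auto simp: indicator_def)
    then show ?thesis using Fint by (rule le_less_trans)
  qed
  ultimately obtain n :: nat where
    FU: "(\<integral>\<^sup>+x. ennreal (F x) * indicator D x * indicator (- U n) x \<partial>M) \<le> ennreal \<eta>"
    using integral_outside_exhaustion[of "\<lambda>x. ennreal (F x) * indicator D x" U \<eta>] \<eta> Uopen
    by (auto simp: open_meas)
  define D' where "D' = D \<inter> U n"
  have Umeas: "U n \<in> sets M" using Uopen by (simp add: open_meas)
  have D'_meas [measurable]: "D' \<in> sets M" unfolding D'_def by (intro sets.Int Umeas D_meas)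
  have FD': "(\<integral>\<^sup>+x. ennreal (F x) * indicator (- D') x \<partial>M) \<le> ennreal (2 * \<eta>)"
  proof -
    have [measurable]: "- D \<in> sets M" "- U n \<in> sets M"
      by (rule compl_meas[OF D_meas], rule compl_meas[OF Umeas])
    have "(\<integral>\<^sup>+x. ennreal (F x) * indicator (- D') x \<partial>M) =
      (\<integral>\<^sup>+x. ennreal (F x) * indicator (- D) x + ennreal (F x) * indicator D x * indicator (- U n) x \<partial>M)"
      by (intro nn_integral_cong) (auto simp: D'_def indicator_def)
    also have "\<dots> = (\<integral>\<^sup>+x. ennreal (F x) * indicator (- D) x \<partial>M) +
        (\<integral>\<^sup>+x. ennreal (F x) * indicator D x * indicator (- U n) x \<partial>M)"
      by (intro nn_integral_add) measurable
    also have "\<dots> \<le> ennreal \<eta> + ennreal \<eta>" using FD FU unfolding D_def by (intro add_mono)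
    also have "\<dots> = ennreal (2 * \<eta>)" using \<eta> by (simp add: ennreal_plus[symmetric] del: ennreal_plus)
    finally show ?thesis .
  qed
  define idx where "idx x = (LEAST i. x \<in> ball (a i) (d/2))" for x
  have idx: "idx x < n" "x \<in> ball (a (idx x)) (d/2)" if "x \<in> D'" for x
  proof -
    obtain i where i: "i < n" "x \<in> ball (a i) (d/2)" using \<open>x \<in> D'\<close> by (auto simp: D'_def U_def)
    show "x \<in> ball (a (idx x)) (d/2)" unfolding idx_def using i(2) by (rule LeastI)
    have "idx x \<le> i" unfolding idx_def using i(2) by (rule Least_le)
    then show "idx x < n" using i by simp
  qed
  have idx_meas [measurable]: "idx \<in> measurable M (count_space UNIV)"
    unfolding idx_def
  proof (rule measurable_Least)
    fix i
    have "ball (a i) (d/2) \<in> sets M" by (simp add: open_meas)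
    then show "Measurable.pred M (\<lambda>x. x \<in> ball (a i) (d/2))" by (simp add: pred_def del: mem_ball)
  qed
  have "compact {-K2..K2}" by (rule compact_Icc)
  then have "seq_compact {-K2..K2}" by (simp add: compact_eq_seq_compact_metric)
  from seq_compact_imp_totally_bounded[OF this] t(1) obtain \<Gamma>
    where \<Gamma>: "finite \<Gamma>" "\<Gamma> \<subseteq> {-K2..K2}" "{-K2..K2} \<subseteq> (\<Union>c\<in>\<Gamma>. ball c t)" by meson
  define step where "step c x = (if x \<in> D' then c (idx x) else (0::real))" for c :: "nat \<Rightarrow> real" and x
  define V where "V = step ` ({..<n} \<rightarrow>\<^sub>E insert 0 \<Gamma>)"
  have step_meas: "step c \<in> borel_measurable M" for c
    unfolding step_def by measurable
  have cK: "\<bar>c i\<bar> \<le> K2" if "c \<in> {..<n} \<rightarrow>\<^sub>E insert 0 \<Gamma>" "i < n" for c i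
  proof -
    have "c i \<in> insert 0 \<Gamma>" using that by blast
    moreover have "insert 0 \<Gamma> \<subseteq> {-K2..K2}" using \<Gamma>(2) K2 by simp
    ultimately have "c i \<in> {-K2..K2}" by blast
    then show ?thesis by auto
  qed
  have step_bd: "\<bar>step c x\<bar> powr r x \<le> K2 powr \<beta> * indicator D x"
    if "c \<in> {..<n} \<rightarrow>\<^sub>E insert 0 \<Gamma>" for c x
  proof (cases "x \<in> D'")
    case True
    then have "x \<in> D" by (simp add: D'_def)
    moreover have "\<bar>c (idx x)\<bar> powr r x \<le> K2 powr \<beta>"
      using cK[OF that idx(1)[OF True]] K2 r_pos[of x] r_upper by (intro powr_le_of_ge_one) auto
    ultimately show ?thesis using True by (simp add: step_def)
  qed (simp add: step_def)
  have "finite V" unfolding V_def using \<Gamma>(1) by (intro finite_imageI finite_PiE) auto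
  moreover have "V \<subseteq> borel_measurable M" using step_meas by (auto simp: V_def)
  moreover have "rmodular v < \<infinity>" if "v \<in> V" for v
  proof -
    obtain c where c: "c \<in> {..<n} \<rightarrow>\<^sub>E insert 0 \<Gamma>" "v = step c" using \<open>v \<in> V\<close> by (auto simp: V_def)
    have "rmodular v \<le> (\<integral>\<^sup>+x. ennreal (K2 powr \<beta>) * indicator D x \<partial>M)"
      unfolding rmodular_def
    proof (rule nn_integral_mono)
      fix x
      have "ennreal (\<bar>v x\<bar> powr r x) \<le> ennreal (K2 powr \<beta> * indicator D x)"
        using step_bd[OF c(1), of x] c(2) by (simp add: ennreal_leI)
      then show "ennreal (\<bar>v x\<bar> powr r x) \<le> ennreal (K2 powr \<beta>) * indicator D x"
        by (simp add: ennreal_mult ennreal_indicator)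
    qed
    also have "\<dots> = ennreal (K2 powr \<beta> * md)"
      using md by (simp add: nn_integral_cmult_indicator ennreal_mult)
    finally show ?thesis by (rule le_less_trans) simp
  qed
  moreover have "\<exists>v\<in>V. rmodular (\<lambda>x. w x - v x) \<le> ennreal e" if w: "w \<in> W" for w
  proof -
    have [measurable]: "w \<in> borel_measurable M" using w W by auto
    obtain G where G [measurable]: "G \<in> borel_measurable M" and G0: "\<And>x. 0 \<le> G x"
      and Gint: "(\<integral>\<^sup>+x. ennreal (G x) \<partial>M) \<le> ennreal \<eta>"
      and Gdom: "AE x in M. \<bar>w x\<bar> powr r x \<le> G x + F x"
      using Fdom[OF w] by blast
    obtain G2 N where G2 [measurable]: "G2 \<in> borel_measurable M" and G20: "\<And>x. 0 \<le> G2 x"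
      and G2int: "rmodular G2 \<le> ennreal \<epsilon>" and N: "N \<in> null_sets M"
      and G2osc: "\<And>x y. x \<notin> N \<Longrightarrow> y \<notin> N \<Longrightarrow> dist x y < d \<Longrightarrow> \<bar>w x - w y\<bar> \<le> G2 x + G2 y"
      using bspec[OF Wosc w] by (metis ComplI)
    define E where "E = {x. t < G2 x}"
    have [measurable]: "E \<in> sets M"
      using measurable_sets[OF G2, of "{t<..}"] by (simp add: vimage_def E_def)
    have Emeas: "ennreal B * emeasure M E \<le> ennreal \<eta>"
    proof -
      have "ennreal B * emeasure M E = ennreal (B / t powr \<beta>) * (ennreal (t powr \<beta>) * emeasure M E)"
        using t B by (simp add: mult.assoc[symmetric] ennreal_mult[symmetric])
      also have "\<dots> \<le> ennreal (B / t powr \<beta>) * ennreal \<epsilon>"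
        unfolding E_def using G20 G2int t by (intro mult_left_mono superlevel_measure_le) auto
      also have "\<dots> = ennreal \<eta>"
        using t B \<epsilon> by (simp add: ennreal_mult[symmetric] \<epsilon>_def)
      finally show ?thesis .
    qed
    (* A cell without a good point gets the value 0: there G > K \<ge> F outside the exceptional set,
       so the function itself is controlled by its remainder. *)
    define good where "good j y \<longleftrightarrow> y \<in> D' \<and> idx y = j \<and> y \<notin> N \<and> G2 y \<le> t \<and> G y \<le> K \<and>
      \<bar>w y\<bar> powr r y \<le> G y + F y" for j y
    have "\<exists>c. c \<in> insert 0 \<Gamma> \<and> ((\<exists>y. good j y \<and> \<bar>w y - c\<bar> < t) \<or> (\<forall>y. \<not> good j y) \<and> c = 0)" for j
    proof (cases "\<exists>y. good j y")
      case True
      then obtain y where y: "good j y" by blast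
      then have "\<bar>w y\<bar> powr r y \<le> 2 * K" using FK[of y] by (auto simp: good_def D'_def)
      then have "\<bar>w y\<bar> \<le> K2" unfolding K2_def
        using K \<alpha>_pos r_lower by (intro le_powr_inverse[of _ "r y"]) auto
      then have "w y \<in> {-K2..K2}" by auto
      then obtain c where "c \<in> \<Gamma>" "w y \<in> ball c t" using \<Gamma>(3) by blast
      then show ?thesis using y
        by (intro exI[of _ c]) (auto simp: dist_real_def abs_minus_commute)
    qed auto
    then obtain c0 where c0: "\<And>j. c0 j \<in> insert 0 \<Gamma>"
      "\<And>j. (\<exists>y. good j y \<and> \<bar>w y - c0 j\<bar> < t) \<or> (\<forall>y. \<not> good j y) \<and> c0 j = 0" by metis
    define c where "c = restrict c0 {..<n}"
    have c: "c \<in> {..<n} \<rightarrow>\<^sub>E insert 0 \<Gamma>" using c0(1) by (auto simp: c_def)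
    define v where "v = step c"
    have [measurable]: "v \<in> borel_measurable M" using step_meas by (simp add: v_def)
    define H where "H x = 2 * G x + F x * indicator (- D') x + (3 * t) powr \<alpha> * indicator D x + B * indicator E x" for x
    have pointwise: "\<bar>w x - v x\<bar> powr r x \<le> C * H x"
      if x: "x \<notin> N" "\<bar>w x\<bar> powr r x \<le> G x + F x" for x
    proof -
      have nn: "0 \<le> G x" "0 \<le> F x * indicator (- D') x" "0 \<le> (3 * t) powr \<alpha> * indicator D x"
        "0 \<le> B * indicator E x" using G0 F0 B by auto
      have "0 \<le> H x" using nn by (simp add: H_def)
      then have H_le: "s \<le> C * H x" if "s \<le> H x" for s
        using mult_right_mono[OF C, of "H x"] that by simp
      consider "x \<notin> D'" | "x \<in> D'" "x \<in> E" | "x \<in> D'" "x \<notin> E" by blast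
      then show ?thesis
      proof cases
        case 1
        then have "\<bar>w x - v x\<bar> powr r x \<le> G x + F x * indicator (- D') x"
          using x by (simp add: v_def step_def)
        then have "\<bar>w x - v x\<bar> powr r x \<le> H x" using nn unfolding H_def by linarith
        then show ?thesis by (rule H_le)
      next
        case 2
        then have xD: "x \<in> D" by (simp add: D'_def)
        have "\<bar>v x\<bar> powr r x \<le> K2 powr \<beta>"
          using step_bd[OF c, of x] xD by (simp add: v_def)
        then have "\<bar>w x\<bar> powr r x + \<bar>v x\<bar> powr r x + 0 powr r x \<le> G x + B * indicator E x"
          using x FK[OF xD] 2 by (simp add: B_def)
        then have "\<bar>w x\<bar> powr r x + \<bar>v x\<bar> powr r x + 0 powr r x \<le> H x"
          using nn unfolding H_def by linarith
        then have "C * (\<bar>w x\<bar> powr r x + \<bar>v x\<bar> powr r x + 0 powr r x) \<le> C * H x"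
          using C by (intro mult_left_mono) auto
        moreover have "\<bar>w x - v x\<bar> powr r x \<le> C * (\<bar>w x\<bar> powr r x + \<bar>v x\<bar> powr r x + 0 powr r x)"
          unfolding C_def using r_pos r_upper by (intro powr_le_sum3) auto
        ultimately show ?thesis by linarith
      next
        case 3
        then have xD: "x \<in> D" and G2x: "G2 x \<le> t" by (auto simp: D'_def E_def)
        have vx: "v x = c0 (idx x)" using 3 idx(1) by (simp add: v_def step_def c_def)
        from c0(2)[of "idx x"] show ?thesis
        proof (elim disjE exE conjE)
          fix y assume y: "good (idx x) y" "\<bar>w y - c0 (idx x)\<bar> < t"
          have "dist x y \<le> dist (a (idx x)) x + dist (a (idx x)) y"
            using dist_triangle3[of x y "a (idx x)"] by simp
          also have "\<dots> < d" using idx(2)[of x] idx(2)[of y] 3 y(1) by (auto simp: good_def)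
          finally have "\<bar>w x - w y\<bar> \<le> G2 x + G2 y" using x(1) y(1) by (intro G2osc) (auto simp: good_def)
          then have "\<bar>w x - v x\<bar> \<le> 3 * t" using G2x y by (auto simp: vx good_def)
          then have "\<bar>w x - v x\<bar> powr r x \<le> (3 * t) powr r x" using r_pos[of x] by (intro powr_mono2) auto
          also have "\<dots> \<le> (3 * t) powr \<alpha>" using t r_lower by (intro powr_le_one_exponent) auto
          finally have "\<bar>w x - v x\<bar> powr r x \<le> (3 * t) powr \<alpha> * indicator D x" using xD by simp
          then have "\<bar>w x - v x\<bar> powr r x \<le> H x" using nn unfolding H_def by linarith
          then show ?thesis by (rule H_le)
        next
          assume n: "\<forall>y. \<not> good (idx x) y" "c0 (idx x) = 0"
          then have "\<not> G x \<le> K" using 3 x G2x by (auto simp: good_def)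
          then have "\<bar>w x - v x\<bar> powr r x \<le> 2 * G x" using x FK[OF xD] n by (simp add: vx)
          then have "\<bar>w x - v x\<bar> powr r x \<le> H x" using nn unfolding H_def by linarith
          then show ?thesis by (rule H_le)
        qed
      qed
    qed
    have [measurable]: "- D' \<in> sets M"
      using D'_meas by (rule compl_meas)
    have eq: "ennreal (C * H x) = ennreal C * (2 * ennreal (G x) + ennreal (F x) * indicator (- D') x
        + ennreal ((3 * t) powr \<alpha>) * indicator D x + ennreal B * indicator E x)" for x
      using G0[of x] F0[of x] B C
      by (simp add: H_def ennreal_mult ennreal_plus ennreal_indicator)
    have "rmodular (\<lambda>x. w x - v x) \<le> (\<integral>\<^sup>+x. ennreal (C * H x) \<partial>M)"
      unfolding rmodular_def
    proof (rule nn_integral_mono_AE)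
      show "AE x in M. ennreal (\<bar>w x - v x\<bar> powr r x) \<le> ennreal (C * H x)"
        using Gdom AE_not_in[OF N] by eventually_elim (rule ennreal_leI, rule pointwise)
    qed
    also have "\<dots> = ennreal C * (2 * (\<integral>\<^sup>+x. ennreal (G x) \<partial>M)
      + (\<integral>\<^sup>+x. ennreal (F x) * indicator (- D') x \<partial>M)
      + ennreal ((3 * t) powr \<alpha>) * emeasure M D + ennreal B * emeasure M E)"
      unfolding eq by (simp add: nn_integral_add nn_integral_cmult nn_integral_cmult_indicator)
    also have "\<dots> \<le> ennreal C * (2 * ennreal \<eta> + ennreal (2 * \<eta>) + ennreal \<eta> + ennreal \<eta>)"
    proof (intro mult_left_mono add_mono)
      show "ennreal ((3 * t) powr \<alpha>) * emeasure M D \<le> ennreal \<eta>"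
        using t\<eta> md by (simp add: ennreal_mult[symmetric] ennreal_leI)
    qed (use Gint FD' Emeas in auto)
    also have "\<dots> = ennreal e"
      using C \<eta> e by (simp add: ennreal_plus[symmetric] ennreal_mult[symmetric]
        ennreal_numeral[symmetric] \<eta>_def del: ennreal_plus ennreal_numeral)
    finally show ?thesis using c by (intro bexI[of _ v]) (auto simp: V_def v_def)
  qed
  ultimately show ?thesis by (intro exI[of _ V] conjI ballI) simp_all
qed

end

section \<open>Small oscillation from bounded gradients\<close>

lemma dyadic_scale:
  fixes t :: real
  assumes "0 < t" "t < (1/2) ^ k0"
  shows "\<exists>k\<ge>k0. (1/2) ^ Suc k \<le> t \<and> t < (1/2) ^ k"
proof -
  have "\<exists>n. (1/2::real) ^ n < t" using assms(1) by (intro real_arch_pow_inv) auto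
  then have ex: "\<exists>n. (1/2::real) ^ n \<le> t" by (auto intro: less_imp_le)
  define n where "n = (LEAST n. (1/2::real) ^ n \<le> t)"
  have n: "(1/2) ^ n \<le> t" unfolding n_def by (rule LeastI_ex[OF ex])
  have "\<not> n \<le> k0"
  proof
    assume "n \<le> k0"
    then have "(1/2::real) ^ k0 \<le> (1/2) ^ n" by (intro power_decreasing) auto
    with n assms(2) show False by linarith
  qed
  then obtain k where k: "n = Suc k" "k0 \<le> k" by (cases n) auto
  have "\<not> (1/2::real) ^ k \<le> t" 
    using k(1) not_less_Least[of k "\<lambda>n. (1/2::real) ^ n \<le> t"] unfolding n_def by simp
  with k n show ?thesis by (intro exI[of _ k]) auto
qed

context variable_exponent
begin

text \<open>The gradient at scale \<open>k\<close> only controls pairs at distance about \<open>2\<^sup>-\<^sup>k\<close>. The factors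
  \<open>\<theta>\<^sup>k\<close> are summable, so the \<open>\<ell>\<^sup>r\<close>-norm \<open>G\<close> of all terms beyond \<open>k0\<close> controls every pair closer
  than \<open>2\<^sup>-\<^sup>k\<^sup>0\<close>, and its modular is at most the tail of a geometric series.\<close>

lemma equi_oscillatingI:
  fixes \<theta> L :: real
  assumes \<theta>: "0 < \<theta>" "\<theta> < 1" and L: "0 \<le> L"
    and grad: "\<And>w. w \<in> W \<Longrightarrow> \<exists>g :: nat \<Rightarrow> 'a \<Rightarrow> real.
      (\<forall>k. g k \<in> borel_measurable M \<and> (\<forall>x. 0 \<le> g k x) \<and> rmodular (g k) \<le> ennreal L) \<and>
      (\<exists>N\<in>null_sets M. \<forall>k. \<forall>x\<in>-N. \<forall>y\<in>-N. (1/2) ^ Suc k \<le> dist x y \<and> dist x y < (1/2) ^ k \<longrightarrow>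
        \<bar>w x - w y\<bar> \<le> \<theta> ^ k * g k x + \<theta> ^ k * g k y)"
  shows "equi_oscillating W"
  unfolding equi_oscillating_def
proof (intro allI impI)
  fix e :: real assume e: "0 < e"
  define q where "q = \<theta> powr \<alpha>"
  have "\<theta> powr \<alpha> < 1 powr \<alpha>" using \<theta> \<alpha>_pos by (intro powr_less_mono2) auto
  then have q: "0 < q" "q < 1" using \<theta> by (simp_all add: q_def)
  obtain k0 where k0: "q ^ k0 < e * (1 - q) / (L + 1)"
    using real_arch_pow_inv[of "e * (1 - q) / (L + 1)" q] q e L by auto
  have small: "L * q ^ k0 / (1 - q) \<le> e"
  proof -
    have "q ^ k0 * (L + 1) < e * (1 - q)" using k0 L by (simp add: field_simps)
    moreover have "L * q ^ k0 \<le> q ^ k0 * (L + 1)" using q by (simp add: field_simps)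
    ultimately have "L * q ^ k0 \<le> e * (1 - q)" by linarith
    then show ?thesis using q by (simp add: pos_divide_le_eq)
  qed
  show "\<exists>d>0. \<forall>w\<in>W. \<exists>G\<in>borel_measurable M. (\<forall>x. 0 \<le> G x) \<and> rmodular G \<le> ennreal e \<and>
    (\<exists>N\<in>null_sets M. \<forall>x\<in>- N. \<forall>y\<in>- N. dist x y < d \<longrightarrow> \<bar>w x - w y\<bar> \<le> G x + G y)"
  proof (intro exI[of _ "(1/2) ^ k0"] conjI ballI)
    fix w assume "w \<in> W"
    from grad[OF this] obtain g :: "nat \<Rightarrow> 'a \<Rightarrow> real" and N
      where g: "\<forall>k. g k \<in> borel_measurable M \<and> (\<forall>x. 0 \<le> g k x) \<and> rmodular (g k) \<le> ennreal L"
        and N: "N \<in> null_sets M"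
        and gN: "\<forall>k. \<forall>x\<in>-N. \<forall>y\<in>-N. (1/2) ^ Suc k \<le> dist x y \<and> dist x y < (1/2) ^ k \<longrightarrow>
          \<bar>w x - w y\<bar> \<le> \<theta> ^ k * g k x + \<theta> ^ k * g k y"
      by (elim exE conjE bexE)
    have [measurable]: "g k \<in> borel_measurable M" and g0: "0 \<le> g k x"
      and gL: "rmodular (g k) \<le> ennreal L" for k x using g by simp_all
    define Z where "Z x = (\<Sum>i. ennreal ((\<theta> ^ (k0 + i) * g (k0 + i) x) powr r x))" for x
    have Zm [measurable]: "Z \<in> borel_measurable M" unfolding Z_def by measurable
    have scaled: "(\<integral>\<^sup>+x. ennreal ((\<theta> ^ k * g k x) powr r x) \<partial>M) \<le> ennreal (q ^ k * L)" for k
    proof -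
      have "(\<theta> ^ k * g k x) powr r x \<le> q ^ k * (\<bar>g k x\<bar> powr r x)" for x
      proof -
        have "(\<theta> ^ k) powr r x \<le> (\<theta> ^ k) powr \<alpha>"
          using \<theta> r_lower by (intro powr_le_one_exponent) (auto intro: power_le_one)
        also have "\<dots> = q ^ k" using \<theta>
          by (simp add: q_def powr_power powr_realpow[symmetric] powr_powr mult.commute)
        finally show ?thesis using \<theta> g0[of k x] by (simp add: powr_mult mult_right_mono)
      qed
      then have "(\<integral>\<^sup>+x. ennreal ((\<theta> ^ k * g k x) powr r x) \<partial>M) \<le>
          (\<integral>\<^sup>+x. ennreal (q ^ k) * ennreal (\<bar>g k x\<bar> powr r x) \<partial>M)"
        using q by (intro nn_integral_mono) (simp add: ennreal_mult[symmetric] ennreal_leI)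
      also have "\<dots> = ennreal (q ^ k) * rmodular (g k)"
        unfolding rmodular_def by (intro nn_integral_cmult) measurable
      also have "\<dots> \<le> ennreal (q ^ k) * ennreal L" using gL by (intro mult_left_mono) auto
      also have "\<dots> = ennreal (q ^ k * L)" using q L by (simp add: ennreal_mult)
      finally show ?thesis .
    qed
    have "(\<integral>\<^sup>+x. Z x \<partial>M) = (\<Sum>i. \<integral>\<^sup>+x. ennreal ((\<theta> ^ (k0 + i) * g (k0 + i) x) powr r x) \<partial>M)"
      unfolding Z_def by (intro nn_integral_suminf) measurable
    also have "\<dots> \<le> (\<Sum>i. ennreal (q ^ (k0 + i) * L))" using scaled by (intro suminf_le) auto
    also have "\<dots> = ennreal (q ^ k0 * L * (1 / (1 - q)))"
    proof (rule suminf_ennreal_eq)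
      have "(\<lambda>i. q ^ k0 * L * q ^ i) sums (q ^ k0 * L * (1 / (1 - q)))"
        using q by (intro sums_mult geometric_sums) auto
      then show "(\<lambda>i. q ^ (k0 + i) * L) sums (q ^ k0 * L * (1 / (1 - q)))"
        by (simp add: power_add mult_ac)
    qed (use q L in auto)
    also have "\<dots> \<le> ennreal e" using small by (intro ennreal_leI) (simp add: mult_ac)
    finally have Zint: "(\<integral>\<^sup>+x. Z x \<partial>M) \<le> ennreal e" .
    then have "(\<integral>\<^sup>+x. Z x \<partial>M) \<noteq> \<infinity>" by (auto simp: top_unique)
    from nn_integral_noteq_infinite[OF Zm this] have "AE x in M. Z x \<noteq> \<infinity>" .
    then obtain N2 where N2: "N2 \<in> null_sets M" "\<And>x. x \<notin> N2 \<Longrightarrow> Z x \<noteq> \<infinity>"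
      by (rule AE_null_setE) blast
    define G where "G x = enn2real (Z x) powr (1 / r x)" for x
    have G0: "0 \<le> G x" for x by (simp add: G_def)
    have [measurable]: "G \<in> borel_measurable M" unfolding G_def by measurable
    have "rmodular G \<le> (\<integral>\<^sup>+x. Z x \<partial>M)" unfolding rmodular_def
    proof (rule nn_integral_mono)
      fix x
      have "\<bar>G x\<bar> powr r x = enn2real (Z x)" using r_pos[of x] by (simp add: G_def powr_powr)
      then show "ennreal (\<bar>G x\<bar> powr r x) \<le> Z x" by (cases "Z x") auto
    qed
    with Zint have "rmodular G \<le> ennreal e" by (rule order_trans[rotated])
    moreover have le_G: "\<theta> ^ k * g k x \<le> G x" if "k0 \<le> k" "x \<notin> N2" for k x
    proof -
      let ?t = "\<theta> ^ k * g k x"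
      have t0: "0 \<le> ?t" using \<theta> g0 by simp
      define f where "f i = ennreal ((\<theta> ^ (k0 + i) * g (k0 + i) x) powr r x)" for i
      have "sum f {k - k0} \<le> suminf f" by (intro sum_le_suminf) auto
      moreover have "k0 + (k - k0) = k" using that(1) by simp
      ultimately have "ennreal (?t powr r x) \<le> Z x" unfolding Z_def f_def by simp
      then have "?t powr r x \<le> enn2real (Z x)" using N2(2)[OF that(2)] by (cases "Z x") auto
      then have "(?t powr r x) powr (1 / r x) \<le> G x"
        unfolding G_def using r_pos[of x] by (intro powr_mono2) auto
      then show ?thesis using t0 r_pos[of x] by (simp add: powr_powr)
    qed
    moreover have "\<bar>w x - w y\<bar> \<le> G x + G y"
      if xy: "x \<notin> N \<union> N2" "y \<notin> N \<union> N2" "dist x y < (1/2) ^ k0" for x y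
    proof (cases "x = y")
      case True
      then show ?thesis using G0[of x] by simp
    next
      case False
      then obtain k where k: "k0 \<le> k" "(1/2) ^ Suc k \<le> dist x y" "dist x y < (1/2) ^ k"
        using dyadic_scale[of "dist x y" k0] xy(3) by auto
      have "\<bar>w x - w y\<bar> \<le> \<theta> ^ k * g k x + \<theta> ^ k * g k y"
        using gN[rule_format, of x y k] xy k by simp
      also have "\<dots> \<le> G x + G y" using le_G[OF k(1)] xy by (intro add_mono) auto
      finally show ?thesis .
    qed
    ultimately show "\<exists>G\<in>borel_measurable M. (\<forall>x. 0 \<le> G x) \<and> rmodular G \<le> ennreal e \<and>
      (\<exists>N\<in>null_sets M. \<forall>x\<in>- N. \<forall>y\<in>- N. dist x y < (1/2) ^ k0 \<longrightarrow> \<bar>w x - w y\<bar> \<le> G x + G y)"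
      using G0 null_sets.Un[OF N N2(1)]
      by (intro bexI[of _ G] conjI bexI[of _ "N \<union> N2"]) auto
  qed simp
qed

end

section \<open>Domination\<close>

context variable_exponent
begin

text \<open>Chebyshev's inequality for the sum of the three functions. The constant \<open>2\<close> in \<open>K\<close> is \<open>1\<close> for the
  modular of \<open>G\<close> and \<open>1\<close> to make the inequality strict.\<close>

lemma point_with_small_values:
  assumes [measurable]: "w \<in> borel_measurable M" "G \<in> borel_measurable M" "h \<in> borel_measurable M"
    and h0: "\<And>x. 0 \<le> h x" and L: "0 \<le> L1" "0 \<le> L2"
    and w: "rmodular w \<le> ennreal L1" and G: "rmodular G \<le> 1"
    and h: "(\<integral>\<^sup>+x. ennreal (h x) \<partial>M) \<le> ennreal L2"
    and N: "N \<in> null_sets M" and d: "0 < d"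
  defines "K \<equiv> L1 + L2 + 2"
  shows "\<exists>y\<in>ball a d - N. \<bar>w y\<bar> powr r y \<le> K / measure M (ball a d) \<and>
    \<bar>G y\<bar> powr r y \<le> K / measure M (ball a d) \<and> h y \<le> K / measure M (ball a d)"
proof (rule ccontr)
  define m where "m = measure M (ball a d)"
  have m: "emeasure M (ball a d) = ennreal m" by (simp add: m_def emeasure_eq_ennreal_measure)
  then have m0: "0 < m" using ball_pos[OF d, of a] by simp
  define \<Phi> where "\<Phi> y = \<bar>w y\<bar> powr r y + \<bar>G y\<bar> powr r y + h y" for y
  assume n: "\<not> ?thesis"
  have ge: "K / m \<le> \<Phi> y" if "y \<in> ball a d" "y \<notin> N" for y
  proof (rule ccontr)
    assume "\<not> K / m \<le> \<Phi> y"
    then have "\<bar>w y\<bar> powr r y \<le> K / m" "\<bar>G y\<bar> powr r y \<le> K / m" "h y \<le> K / m"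
      using h0[of y] powr_ge_zero[of "\<bar>w y\<bar>" "r y"] powr_ge_zero[of "\<bar>G y\<bar>" "r y"]
      unfolding \<Phi>_def by linarith+
    with that n show False unfolding m_def by blast
  qed
  have K0: "0 \<le> K" using L by (simp add: K_def)
  have "ennreal K = ennreal (K / m) * emeasure M (ball a d)"
    unfolding m using m0 K0 by (simp add: ennreal_mult[symmetric])
  also have "\<dots> = (\<integral>\<^sup>+y. ennreal (K / m) * indicator (ball a d) y \<partial>M)"
    by (simp add: nn_integral_cmult_indicator)
  also have "\<dots> \<le> (\<integral>\<^sup>+y. ennreal (\<Phi> y) \<partial>M)"
  proof (rule nn_integral_mono_AE)
    show "AE y in M. ennreal (K / m) * indicator (ball a d) y \<le> ennreal (\<Phi> y)"
      using AE_not_in[OF N]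
    proof eventually_elim
      case (elim y)
      show ?case using ge[of y] elim by (cases "y \<in> ball a d") (auto intro: ennreal_leI)
    qed
  qed
  also have "\<dots> = rmodular w + rmodular G + (\<integral>\<^sup>+x. ennreal (h x) \<partial>M)"
    unfolding \<Phi>_def rmodular_def using h0
    by (simp add: nn_integral_add)
  also have "\<dots> \<le> ennreal L1 + 1 + ennreal L2" using w G h by (intro add_mono)
  also have "\<dots> = ennreal (L1 + 1 + L2)" using L by simp
  finally show False using L by (simp add: K_def)
qed

text \<open>Domination only needs to be checked for one function \<open>G\<close> of small modular, which bounds the
  oscillation at some scale \<open>d\<close>: its power is the remainder, and what is left to find is an
  integrable function that depends on \<open>d\<close> alone.\<close>

lemma equi_dominatedI:
  assumes osc: "equi_oscillating W"
    and dominate: "\<And>d. 0 < d \<Longrightarrow> \<exists>F\<in>borel_measurable M. (\<forall>x. 0 \<le> F x) \<and> (\<integral>\<^sup>+x. ennreal (F x) \<partial>M) < \<infinity> \<and>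
      (\<forall>w\<in>W. \<forall>G\<in>borel_measurable M. \<forall>N\<in>null_sets M. rmodular G \<le> 1 \<longrightarrow>
        (\<forall>x\<in>-N. \<forall>y\<in>-N. dist x y < d \<longrightarrow> \<bar>w x - w y\<bar> \<le> G x + G y) \<longrightarrow>
        (AE x in M. \<bar>w x\<bar> powr r x \<le> 3 powr \<beta> * (\<bar>G x\<bar> powr r x) + F x))"
  shows "equi_dominated W"
  unfolding equi_dominated_def
proof (intro allI impI)
  fix e :: real assume e: "0 < e"
  define e' where "e' = min 1 (e / 3 powr \<beta>)"
  have e': "0 < e'" "e' \<le> 1" "3 powr \<beta> * e' \<le> e"
    using e by (auto simp: e'_def min_def field_simps)
  from osc[unfolded equi_oscillating_def, rule_format, OF e'(1)] obtain d where d: "0 < d"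
    and Wosc: "\<forall>w\<in>W. \<exists>G\<in>borel_measurable M. (\<forall>x. 0 \<le> G x) \<and> rmodular G \<le> ennreal e' \<and>
     (\<exists>N\<in>null_sets M. \<forall>x\<in>-N. \<forall>y\<in>-N. dist x y < d \<longrightarrow> \<bar>w x - w y\<bar> \<le> G x + G y)"
    by (elim exE conjE)
  from dominate[OF d] obtain F where F: "F \<in> borel_measurable M" "\<forall>x. 0 \<le> F x"
      "(\<integral>\<^sup>+x. ennreal (F x) \<partial>M) < \<infinity>"
    and Fdom: "\<forall>w\<in>W. \<forall>G\<in>borel_measurable M. \<forall>N\<in>null_sets M. rmodular G \<le> 1 \<longrightarrow>
        (\<forall>x\<in>-N. \<forall>y\<in>-N. dist x y < d \<longrightarrow> \<bar>w x - w y\<bar> \<le> G x + G y) \<longrightarrow>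
        (AE x in M. \<bar>w x\<bar> powr r x \<le> 3 powr \<beta> * (\<bar>G x\<bar> powr r x) + F x)"
    by (elim bexE conjE)
  have "\<exists>G\<in>borel_measurable M. (\<forall>x. 0 \<le> G x) \<and> (\<integral>\<^sup>+x. ennreal (G x) \<partial>M) \<le> ennreal e \<and>
       (AE x in M. \<bar>w x\<bar> powr r x \<le> G x + F x)" if w: "w \<in> W" for w
  proof -
    from bspec[OF Wosc w] obtain G N where G [measurable]: "G \<in> borel_measurable M"
      and Gint: "rmodular G \<le> ennreal e'" and N: "N \<in> null_sets M"
      and GN: "\<forall>x\<in>-N. \<forall>y\<in>-N. dist x y < d \<longrightarrow> \<bar>w x - w y\<bar> \<le> G x + G y"
      by (elim bexE conjE)
    have "rmodular G \<le> 1" using Gint e'(2) order_trans[of _ "ennreal e'" 1] by simp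
    then have "AE x in M. \<bar>w x\<bar> powr r x \<le> 3 powr \<beta> * (\<bar>G x\<bar> powr r x) + F x"
      using Fdom w G N GN by blast
    moreover have "(\<integral>\<^sup>+x. ennreal (3 powr \<beta> * (\<bar>G x\<bar> powr r x)) \<partial>M) \<le> ennreal e"
    proof -
      have "(\<integral>\<^sup>+x. ennreal (3 powr \<beta> * (\<bar>G x\<bar> powr r x)) \<partial>M) = ennreal (3 powr \<beta>) * rmodular G"
        unfolding rmodular_def by (simp add: ennreal_mult nn_integral_cmult)
      also have "\<dots> \<le> ennreal (3 powr \<beta>) * ennreal e'" using Gint by (intro mult_left_mono) auto
      also have "\<dots> \<le> ennreal e" using e' by (simp add: ennreal_mult[symmetric] ennreal_leI)
      finally show ?thesis .
    qed
    ultimately show ?thesis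
      by (intro bexI[of _ "\<lambda>x. 3 powr \<beta> * (\<bar>G x\<bar> powr r x)"] conjI) auto
  qed
  then show "\<exists>F\<in>borel_measurable M. (\<forall>x. 0 \<le> F x) \<and> (\<integral>\<^sup>+x. ennreal (F x) \<partial>M) < \<infinity> \<and>
     (\<forall>w\<in>W. \<exists>G\<in>borel_measurable M. (\<forall>x. 0 \<le> G x) \<and> (\<integral>\<^sup>+x. ennreal (G x) \<partial>M) \<le> ennreal e \<and>
       (AE x in M. \<bar>w x\<bar> powr r x \<le> G x + F x))"
    using F by (intro bexI[of _ F] conjI) auto
qed

text \<open>In a totally bounded space finitely many balls of the scale on which the oscillation is
  controlled cover everything, and each contains a point where the function is bounded
  in terms of the measure of the ball. So the function is, up to its oscillation, bounded by a
  constant.\<close>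

lemma equi_dominated_totally_bounded:
  assumes W: "W \<subseteq> borel_measurable M" and osc: "equi_oscillating W"
    and L: "0 \<le> L" and bd: "\<And>w. w \<in> W \<Longrightarrow> rmodular w \<le> ennreal L"
    and tb: "totally_bounded (UNIV :: 'a set)"
  shows "equi_dominated W"
proof (rule equi_dominatedI[OF osc])
  fix d :: real assume d: "0 < d"
  have "0 < d / 2" using d by simp
  with tb obtain A :: "'a set" where A: "finite A" "UNIV \<subseteq> (\<Union>a\<in>A. {y. dist a y < d / 2})"
    unfolding totally_bounded_metric by blast
  have ballA: "\<exists>a\<in>A. x \<in> ball a (d/2)" for x using A(2) by auto
  have "emeasure M UNIV \<le> emeasure M (\<Union>a\<in>A. ball a (d/2))"
    using ballA A(1) by (intro emeasure_mono) auto
  also have "\<dots> \<le> (\<Sum>a\<in>A. emeasure M (ball a (d/2)))"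
    using A(1) by (intro emeasure_subadditive_finite) auto
  also have "\<dots> < top" using A(1) by (simp add: less_top[symmetric])
  finally have fin: "emeasure M UNIV < top" .
  define K where "K = L + 0 + 2"
  define K0 where "K0 = 1 + (\<Sum>a\<in>A. K / measure M (ball a (d/2)))"
  have summand: "0 \<le> K / measure M (ball a (d/2))" for a using L by (simp add: K_def)
  have K0: "1 \<le> K0" unfolding K0_def using summand by (simp add: sum_nonneg)
  have K0_ge: "K / measure M (ball a (d/2)) \<le> K0" if "a \<in> A" for a
    using member_le_sum[OF that, of "\<lambda>a. K / measure M (ball a (d/2))"] summand A(1)
    unfolding K0_def by simp
  define T where "T = K0 powr (1 / \<alpha>)"
  have T: "1 \<le> T" unfolding T_def using K0 \<alpha>_pos by (intro ge_one_powr_ge_zero) auto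
  define F :: "'a \<Rightarrow> real" where "F x = 3 powr \<beta> * (2 * T powr \<beta>)" for x
  have Fm: "F \<in> borel_measurable M" by (simp add: F_def[abs_def])
  have "(\<integral>\<^sup>+x. ennreal (F x) \<partial>M) = ennreal (3 powr \<beta> * (2 * T powr \<beta>)) * emeasure M UNIV"
    by (simp add: F_def)
  also have "\<dots> < top" using fin by (intro ennreal_mult_less_top[THEN iffD2]) simp
  finally have Fint: "(\<integral>\<^sup>+x. ennreal (F x) \<partial>M) < \<infinity>" by simp
  have dom: "AE x in M. \<bar>w x\<bar> powr r x \<le> 3 powr \<beta> * (\<bar>G x\<bar> powr r x) + F x"
    if w: "w \<in> W" and G [measurable]: "G \<in> borel_measurable M" and N: "N \<in> null_sets M"
      and G1: "rmodular G \<le> 1"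
      and GN: "\<forall>x\<in>-N. \<forall>y\<in>-N. dist x y < d \<longrightarrow> \<bar>w x - w y\<bar> \<le> G x + G y" for w G N
  proof -
    have [measurable]: "w \<in> borel_measurable M" using w W by auto
    have "\<bar>w x\<bar> powr r x \<le> 3 powr \<beta> * (\<bar>G x\<bar> powr r x) + F x" if x: "x \<notin> N" for x
    proof -
      obtain a where a: "a \<in> A" "x \<in> ball a (d/2)" using ballA by blast
      obtain y where y: "y \<in> ball a (d/2) - N"
        "\<bar>w y\<bar> powr r y \<le> K / measure M (ball a (d/2))" "\<bar>G y\<bar> powr r y \<le> K / measure M (ball a (d/2))"
        using point_with_small_values[of w G "\<lambda>_. 0" L 0 N "d/2" a] L bd[OF w] G1 N d
        unfolding K_def by auto
      have "dist x y < d"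
        using dist_triangle3[of x y a] a y(1) by auto
      then have "\<bar>w x - w y\<bar> \<le> G x + G y" using GN x y by auto
      then have tri: "\<bar>w x\<bar> \<le> \<bar>G x\<bar> + \<bar>w y\<bar> + \<bar>G y\<bar>" by linarith
      have "\<bar>w y\<bar> \<le> T" "\<bar>G y\<bar> \<le> T" unfolding T_def
        using K0_ge[OF a(1)] y K0 \<alpha>_pos r_lower
        by (auto intro!: le_powr_inverse[of _ "r y"])
      then have "\<bar>w y\<bar> powr r x \<le> T powr \<beta>" "\<bar>G y\<bar> powr r x \<le> T powr \<beta>"
        using T r_pos[of x] r_upper by (auto intro!: powr_le_of_ge_one)
      then have "3 powr \<beta> * (\<bar>G x\<bar> powr r x + \<bar>w y\<bar> powr r x + \<bar>G y\<bar> powr r x)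
          \<le> 3 powr \<beta> * (\<bar>G x\<bar> powr r x + 2 * T powr \<beta>)"
        by (intro mult_left_mono) auto
      moreover have "\<bar>w x\<bar> powr r x \<le> 3 powr \<beta> * (\<bar>G x\<bar> powr r x + \<bar>w y\<bar> powr r x + \<bar>G y\<bar> powr r x)"
        using tri r_pos r_upper by (intro powr_le_sum3) auto
      ultimately show ?thesis by (simp add: F_def algebra_simps)
    qed
    then show ?thesis using AE_not_in[OF N] by auto
  qed
  have F0: "\<forall>x. 0 \<le> F x" by (simp add: F_def)
  show "\<exists>F\<in>borel_measurable M. (\<forall>x. 0 \<le> F x) \<and> (\<integral>\<^sup>+x. ennreal (F x) \<partial>M) < \<infinity> \<and>
      (\<forall>w\<in>W. \<forall>G\<in>borel_measurable M. \<forall>N\<in>null_sets M. rmodular G \<le> 1 \<longrightarrow>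
        (\<forall>x\<in>-N. \<forall>y\<in>-N. dist x y < d \<longrightarrow> \<bar>w x - w y\<bar> \<le> G x + G y) \<longrightarrow>
        (AE x in M. \<bar>w x\<bar> powr r x \<le> 3 powr \<beta> * (\<bar>G x\<bar> powr r x) + F x))"
    by (intro bexI[OF _ Fm] conjI F0 Fint ballI impI) (rule dom)
qed

text \<open>Transfer of a bound from one exponent to another, where \<open>m\<close> stands for the measure of a
  ball. If \<open>m \<le> 1\<close> this costs a power of \<open>m\<close> controlled by the log-Hoelder condition; if \<open>m > 1\<close>
  the bounded quantity is small, and the decay condition is used instead.\<close>

lemma change_exponent:
  fixes z m K C1 \<kappa> rx ry hx hy :: real
  assumes z: "0 \<le> z" "z powr ry \<le> K / m" and hy: "hy \<le> K / m" and hx: "0 \<le> hx"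
    and m: "0 < m" and K: "1 \<le> K" and C1: "1 \<le> C1" and \<kappa>: "0 < \<kappa>" "\<kappa> \<le> 1"
    and rx: "\<alpha> \<le> rx" "rx \<le> \<beta>" and ry: "\<alpha> \<le> ry" "ry \<le> \<beta>"
    and holder: "m \<le> 1 \<Longrightarrow> m powr (1 / rx - 1 / ry) \<le> C1"
    and decay: "\<And>z c. 0 \<le> z \<Longrightarrow> z \<le> 1 \<Longrightarrow> z powr ry \<le> c \<Longrightarrow> hy \<le> c \<Longrightarrow> (\<kappa> * z) powr rx \<le> c + hx"
  shows "z powr rx \<le> (K powr (\<beta> / \<alpha>) * C1 powr \<beta> + (K powr (1 / \<alpha>) / \<kappa>) powr \<beta> * K) * (1 / m + hx)"
    (is "_ \<le> (?A + ?B) * _")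
proof -
  have pos: "0 < rx" "0 < ry" using rx ry \<alpha>_pos by auto
  have AB: "0 \<le> ?A" "0 \<le> ?B" using K by auto
  have s: "0 \<le> 1 / m + hx" using m hx by simp
  show ?thesis
  proof (cases "m \<le> 1")
    case True
    have "z powr rx = (z powr ry) powr (rx / ry)" using pos by (simp add: powr_powr)
    also have "\<dots> \<le> (K / m) powr (rx / ry)" using z pos by (intro powr_mono2) auto
    also have "\<dots> = K powr (rx / ry) * (1 / m) powr (rx / ry)"
      using K m powr_mult[of K "1 / m" "rx / ry"] by simp
    also have "(1 / m) powr (rx / ry) = (1 / m) * (m powr (1 / rx - 1 / ry)) powr rx"
    proof -
      have "(1 / m) * (m powr (1 / rx - 1 / ry)) powr rx = m powr (- 1) * m powr ((1 / rx - 1 / ry) * rx)"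
        using m by (simp add: powr_powr powr_minus_divide)
      also have "\<dots> = m powr (- (rx / ry))"
      proof -
        have "- 1 + (1 / rx - 1 / ry) * rx = - (rx / ry)" using pos by (simp add: field_simps)
        then show ?thesis by (simp only: powr_add[symmetric])
      qed
      also have "\<dots> = (1 / m) powr (rx / ry)" using m by (simp add: powr_minus_divide powr_divide)
      finally show ?thesis ..
    qed
    also have "K powr (rx / ry) * ((1 / m) * (m powr (1 / rx - 1 / ry)) powr rx)
        \<le> K powr (\<beta> / \<alpha>) * ((1 / m) * C1 powr \<beta>)"
    proof (intro mult_mono)
      show "K powr (rx / ry) \<le> K powr (\<beta> / \<alpha>)"
        using K rx ry \<alpha>_pos pos by (intro powr_mono frac_le) auto
      show "(m powr (1 / rx - 1 / ry)) powr rx \<le> C1 powr \<beta>"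
        using holder[OF True] C1 pos rx by (intro powr_le_of_ge_one) auto
    qed (use m K in auto)
    also have "\<dots> = ?A * (1 / m)" by simp
    also have "\<dots> \<le> (?A + ?B) * (1 / m + hx)" using AB m hx by (intro mult_mono) auto
    finally show ?thesis .
  next
    case False
    define T where "T = K powr (1 / \<alpha>)"
    have T: "1 \<le> T" unfolding T_def using K \<alpha>_pos by (intro ge_one_powr_ge_zero) auto
    have Km: "K / m \<le> K" using False K by (simp add: field_simps)
    then have zT: "z \<le> T" unfolding T_def using z K \<alpha>_pos ry by (intro le_powr_inverse[of _ ry]) auto
    have "K powr 1 \<le> K powr (ry / \<alpha>)" using K \<alpha>_pos ry by (intro powr_mono) auto
    also have "\<dots> = T powr ry" by (simp add: T_def powr_powr)
    finally have TK: "1 \<le> T powr ry" using K by simp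
    have "(z / T) powr ry = z powr ry / T powr ry" using z T by (simp add: powr_divide)
    also have "\<dots> \<le> z powr ry / 1" using TK by (intro divide_left_mono) auto
    finally have "(z / T) powr ry \<le> K / m" using z by simp
    then have d: "(\<kappa> * (z / T)) powr rx \<le> K / m + hx"
      using z zT T hy by (intro decay) auto
    have "z powr rx = (T / \<kappa> * (\<kappa> * (z / T))) powr rx" using T \<kappa> by simp
    also have "\<dots> = (T / \<kappa>) powr rx * (\<kappa> * (z / T)) powr rx" by (rule powr_mult)
    also have "\<dots> \<le> (T / \<kappa>) powr \<beta> * (K * (1 / m + hx))"
    proof (intro mult_mono)
      show "(T / \<kappa>) powr rx \<le> (T / \<kappa>) powr \<beta>" using T \<kappa> rx by (intro powr_mono) auto
      have "hx \<le> K * hx" using mult_right_mono[OF K hx] by simp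
      then show "(\<kappa> * (z / T)) powr rx \<le> K * (1 / m + hx)" using d by (simp add: algebra_simps)
    qed auto
    also have "\<dots> = ?B * (1 / m + hx)" by (simp add: T_def)
    also have "\<dots> \<le> (?A + ?B) * (1 / m + hx)" using AB s by (intro mult_right_mono) auto
    finally show ?thesis .
  qed
qed

text \<open>Here the balls of a countable cover may have arbitrarily small or large measure, and the
  dominating function is, up to a multiple of \<open>h\<close>, the reciprocal of the measure of the ball assigned to
  the point. Its integral is finite because the measure is integrable.\<close>

lemma equi_dominated_integrable:
  assumes W: "W \<subseteq> borel_measurable M" and osc: "equi_oscillating W"
    and L: "0 \<le> L" and bd: "\<And>w. w \<in> W \<Longrightarrow> rmodular w \<le> ennreal L"
    and int: "\<And>d. 0 < d \<Longrightarrow> (\<integral>\<^sup>+x. 1 / emeasure M (ball x d) \<partial>M) < \<infinity>"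
    and C1: "1 \<le> C1"
    and holder: "\<And>a d. 0 < d \<Longrightarrow> \<exists>N\<in>null_sets M. \<forall>x\<in>ball a d - N. \<forall>y\<in>ball a d - N.
      measure M (ball a d) \<le> 1 \<longrightarrow> measure M (ball a d) powr (1 / r x - 1 / r y) \<le> C1"
    and hm [measurable]: "h \<in> borel_measurable M" and h0: "\<And>x. 0 \<le> h x"
    and hint: "(\<integral>\<^sup>+x. ennreal (h x) \<partial>M) < \<infinity>" and \<kappa>: "0 < \<kappa>" "\<kappa> \<le> 1"
    and decay: "\<And>x y z c. 0 \<le> z \<Longrightarrow> z \<le> 1 \<Longrightarrow> z powr r y \<le> c \<Longrightarrow> h y \<le> c \<Longrightarrow>
      (\<kappa> * z) powr r x \<le> c + h x"
  shows "equi_dominated W"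
proof (rule equi_dominatedI[OF osc])
  fix d :: real assume d: "0 < d"
  have d4: "0 < d / 4" "0 < d / 2" using d by simp_all
  obtain a :: "nat \<Rightarrow> 'a" where a: "(\<Union>i. ball (a i) (d/4)) = UNIV"
    using countable_ball_cover[OF d4(1)] by blast
  define m where "m i = measure M (ball (a i) (d/2))" for i
  have em: "emeasure M (ball (a i) (d/2)) = ennreal (m i)" for i
    by (simp add: m_def emeasure_eq_ennreal_measure)
  have m0: "0 < m i" for i using ball_pos[OF d4(2), of "a i"] em[of i] by simp
  define idx where "idx x = (LEAST i. x \<in> ball (a i) (d/4))" for x
  have idx: "x \<in> ball (a (idx x)) (d/4)" for x
  proof -
    have "\<exists>i. x \<in> ball (a i) (d/4)" using a by blast
    then show ?thesis unfolding idx_def by (rule LeastI_ex)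
  qed
  have idx_meas [measurable]: "idx \<in> measurable M (count_space UNIV)"
    unfolding idx_def
  proof (rule measurable_Least)
    fix i show "Measurable.pred M (\<lambda>x. x \<in> ball (a i) (d/4))" by (simp add: pred_def del: mem_ball)
  qed
  obtain H where H: "(\<integral>\<^sup>+x. ennreal (h x) \<partial>M) = ennreal H" "0 \<le> H"
    using hint by (cases "\<integral>\<^sup>+x. ennreal (h x) \<partial>M") auto
  define K where "K = L + H + 2"
  have K: "1 \<le> K" using L H by (simp add: K_def)
  have "\<forall>i. \<exists>N\<in>null_sets M. \<forall>x\<in>ball (a i) (d/2) - N. \<forall>y\<in>ball (a i) (d/2) - N.
      m i \<le> 1 \<longrightarrow> m i powr (1 / r x - 1 / r y) \<le> C1"
    using holder[OF d4(2)] unfolding m_def by blast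
  then obtain NN where NN: "\<forall>i. NN i \<in> null_sets M \<and> (\<forall>x\<in>ball (a i) (d/2) - NN i.
      \<forall>y\<in>ball (a i) (d/2) - NN i. m i \<le> 1 \<longrightarrow> m i powr (1 / r x - 1 / r y) \<le> C1)" by metis
  define N0 where "N0 = (\<Union>i. NN i)"
  have N0: "N0 \<in> null_sets M" unfolding N0_def using NN by (intro null_sets_UN) auto
  define A where "A = K powr (\<beta> / \<alpha>) * C1 powr \<beta> + (K powr (1 / \<alpha>) / \<kappa>) powr \<beta> * K"
  have A0: "0 \<le> A" using K by (simp add: A_def)
  define F :: "'a \<Rightarrow> real" where "F x = 3 powr \<beta> * (2 * A) * (1 / m (idx x) + h x)" for x
  have Fm: "F \<in> borel_measurable M" unfolding F_def by measurable
  have F_nonneg: "0 \<le> F x" for x using A0 h0[of x] m0[of "idx x"] by (simp add: F_def)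
  have "(\<integral>\<^sup>+x. ennreal (1 / m (idx x)) \<partial>M) \<le> (\<integral>\<^sup>+x. 1 / emeasure M (ball x (d/4)) \<partial>M)"
  proof (rule nn_integral_mono)
    fix x
    have "ball x (d/4) \<subseteq> ball (a (idx x)) (d/2)"
    proof
      fix y assume "y \<in> ball x (d/4)"
      then show "y \<in> ball (a (idx x)) (d/2)"
        using idx[of x] dist_triangle[of "a (idx x)" y x] by simp
    qed
    then have "emeasure M (ball x (d/4)) \<le> ennreal (m (idx x))"
      unfolding em[symmetric] by (intro emeasure_mono) auto
    moreover obtain m' where m': "emeasure M (ball x (d/4)) = ennreal m'" "0 \<le> m'"
      using ball_ne_top[of x "d/4"] by (cases "emeasure M (ball x (d/4))") auto
    moreover have "0 < m'" using ball_pos[OF d4(1), of x] m' by simp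
    ultimately have "1 / m (idx x) \<le> 1 / m'"
      using m0[of "idx x"] by (intro divide_left_mono) (auto simp: ennreal_le_iff less_imp_le)
    then have "ennreal (1 / m (idx x)) \<le> ennreal (1 / m')" by (rule ennreal_leI)
    also have "\<dots> = 1 / emeasure M (ball x (d/4))"
      using divide_ennreal[of 1 m'] m'(1) \<open>0 < m'\<close> by simp
    finally show "ennreal (1 / m (idx x)) \<le> 1 / emeasure M (ball x (d/4))" .
  qed
  then have mint: "(\<integral>\<^sup>+x. ennreal (1 / m (idx x)) \<partial>M) < top"
    using int[OF d4(1)] by (simp add: le_less_trans)
  have "(\<integral>\<^sup>+x. ennreal (F x) \<partial>M) =
      (\<integral>\<^sup>+x. ennreal (3 powr \<beta> * (2 * A)) * (ennreal (1 / m (idx x)) + ennreal (h x)) \<partial>M)"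
    using A0 h0 m0 by (intro nn_integral_cong)
      (simp add: F_def ennreal_mult[symmetric] ennreal_plus[symmetric] less_imp_le del: ennreal_plus)
  also have "\<dots> = ennreal (3 powr \<beta> * (2 * A)) *
      ((\<integral>\<^sup>+x. ennreal (1 / m (idx x)) \<partial>M) + (\<integral>\<^sup>+x. ennreal (h x) \<partial>M))"
    by (subst nn_integral_cmult, measurable, subst nn_integral_add, measurable)
  also have "\<dots> < top" using mint hint by (simp add: ennreal_mult_less_top)
  finally have Fint: "(\<integral>\<^sup>+x. ennreal (F x) \<partial>M) < \<infinity>" by simp
  have dom: "AE x in M. \<bar>w x\<bar> powr r x \<le> 3 powr \<beta> * (\<bar>G x\<bar> powr r x) + F x"
    if w: "w \<in> W" and G [measurable]: "G \<in> borel_measurable M" and N: "N \<in> null_sets M"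
      and G1: "rmodular G \<le> 1"
      and GN: "\<forall>x\<in>-N. \<forall>y\<in>-N. dist x y < d \<longrightarrow> \<bar>w x - w y\<bar> \<le> G x + G y" for w G N
  proof -
    have [measurable]: "w \<in> borel_measurable M" using w W by auto
    have N': "N \<union> N0 \<in> null_sets M" using N N0 by (rule null_sets.Un)
    have "\<bar>w x\<bar> powr r x \<le> 3 powr \<beta> * (\<bar>G x\<bar> powr r x) + F x" if x: "x \<notin> N \<union> N0" for x
    proof -
      define i where "i = idx x"
      have xi: "x \<in> ball (a i) (d/4)" using idx by (simp add: i_def)
      have "\<exists>y\<in>ball (a i) (d/2) - (N \<union> N0). \<bar>w y\<bar> powr r y \<le> K / m i \<and>
          \<bar>G y\<bar> powr r y \<le> K / m i \<and> h y \<le> K / m i"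
        unfolding K_def m_def
        by (rule point_with_small_values) (use L H h0 bd[OF w] G1 N' d4 in simp_all)
      then obtain y where y: "y \<in> ball (a i) (d/2) - (N \<union> N0)"
        "\<bar>w y\<bar> powr r y \<le> K / m i" "\<bar>G y\<bar> powr r y \<le> K / m i" "h y \<le> K / m i" by blast
      have "dist x y < d"
        using dist_triangle3[of x y "a i"] xi y(1) d by auto
      then have "\<bar>w x - w y\<bar> \<le> G x + G y" using GN x y by auto
      then have tri: "\<bar>w x\<bar> \<le> \<bar>G x\<bar> + \<bar>w y\<bar> + \<bar>G y\<bar>" by linarith
      have loc: "m i powr (1 / r x - 1 / r y) \<le> C1" if "m i \<le> 1"
      proof -
        have "x \<in> ball (a i) (d/2) - NN i" "y \<in> ball (a i) (d/2) - NN i"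
          using x y(1) xi d by (auto simp: N0_def)
        then show ?thesis using NN that by blast
      qed
      have tr: "z powr r x \<le> A * (1 / m i + h x)" if "0 \<le> z" "z powr r y \<le> K / m i" for z
        unfolding A_def using that y(4) h0[of x] m0[of i] K C1 \<kappa> r_lower[of x] r_upper[of x]
          r_lower[of y] r_upper[of y] loc decay[of _ y _ x]
        by (rule change_exponent)
      have "3 powr \<beta> * (\<bar>G x\<bar> powr r x + \<bar>w y\<bar> powr r x + \<bar>G y\<bar> powr r x)
          \<le> 3 powr \<beta> * (\<bar>G x\<bar> powr r x + 2 * A * (1 / m i + h x))"
        using tr[of "\<bar>w y\<bar>"] tr[of "\<bar>G y\<bar>"] y by (intro mult_left_mono) auto
      moreover have "\<bar>w x\<bar> powr r x \<le> 3 powr \<beta> * (\<bar>G x\<bar> powr r x + \<bar>w y\<bar> powr r x + \<bar>G y\<bar> powr r x)"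
        using tri r_pos r_upper by (intro powr_le_sum3) auto
      ultimately have "\<bar>w x\<bar> powr r x \<le> 3 powr \<beta> * (\<bar>G x\<bar> powr r x + 2 * A * (1 / m i + h x))"
        by (rule order_trans[rotated])
      then show ?thesis by (simp only: F_def i_def distrib_left mult.assoc)
    qed
    then show ?thesis using AE_not_in[OF N'] by auto
  qed
  have F0: "\<forall>x. 0 \<le> F x" using F_nonneg by simp
  show "\<exists>F\<in>borel_measurable M. (\<forall>x. 0 \<le> F x) \<and> (\<integral>\<^sup>+x. ennreal (F x) \<partial>M) < \<infinity> \<and>
      (\<forall>w\<in>W. \<forall>G\<in>borel_measurable M. \<forall>N\<in>null_sets M. rmodular G \<le> 1 \<longrightarrow>
        (\<forall>x\<in>-N. \<forall>y\<in>-N. dist x y < d \<longrightarrow> \<bar>w x - w y\<bar> \<le> G x + G y) \<longrightarrow>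
        (AE x in M. \<bar>w x\<bar> powr r x \<le> 3 powr \<beta> * (\<bar>G x\<bar> powr r x) + F x))"
    by (intro bexI[OF _ Fm] conjI F0 Fint ballI impI) (rule dom)
qed

end

section \<open>Essential bounds of exponents\<close>

text \<open>The supremum which defines the essential infimum is attained: it is the supremum of a
  sequence of almost everywhere lower bounds.\<close>

lemma essinf_AE: "AE x in M. essinf M f \<le> f x"
proof -
  define A where "A = {z. AE x in M. z \<le> f x}"
  have "0 \<in> A" by (simp add: A_def)
  then have "A \<noteq> {}" by blast
  from ennreal_Sup_countable_SUP[OF this] obtain z :: "nat \<Rightarrow> ennreal"
    where z: "range z \<subseteq> A" "Sup A = (SUP i. z i)" by blast
  have "AE x in M. \<forall>i. z i \<le> f x" using z(1) by (subst AE_all_countable) (auto simp: A_def)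
  then show ?thesis unfolding essinf_def A_def[symmetric] z(2)
    by eventually_elim (auto intro: SUP_least)
qed

lemma exp_inf_AE:
  assumes "E \<in> sets M"
  shows "AE x in M. x \<in> E \<longrightarrow> exp_inf M E p \<le> p x"
  using essinf_AE[of "restrict_space M E" p] assms
  by (simp add: exp_inf_def AE_restrict_space_iff sets.Int_space_eq2)

lemma exp_sup_AE:
  assumes "E \<in> sets M"
  shows "AE x in M. x \<in> E \<longrightarrow> p x \<le> exp_sup M E p"
  using esssup_AE[of p "restrict_space M E"] assms
  by (simp add: exp_sup_def AE_restrict_space_iff sets.Int_space_eq2)

lemma exp_inf_geI:
  assumes "E \<in> sets M" "AE x in M. c \<le> p x"
  shows "c \<le> exp_inf M E p"
proof -
  have "AE x in restrict_space M E. c \<le> p x"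
    using assms by (subst AE_restrict_space_iff) (auto simp: sets.Int_space_eq2)
  then show ?thesis unfolding exp_inf_def essinf_def by (intro Sup_upper) simp
qed

lemma exponents_lower_bound:
  assumes "q \<in> exponents M"
  shows "\<exists>c::real>0. AE x in M. ennreal c \<le> q x"
proof -
  define c where "c = enn2real (min 1 (exp_inf M (space M) q))"
  have pos: "0 < exp_inf M (space M) q" using assms by (simp add: exponents_def)
  have c: "ennreal c = min 1 (exp_inf M (space M) q)"
    unfolding c_def by (intro ennreal_enn2real) (auto simp: min_less_iff_disj)
  have "0 < ennreal c" unfolding c using pos by simp
  moreover have "AE x in M. ennreal c \<le> q x"
    using exp_inf_AE[of "space M" M q] unfolding c
    by (rule AE_mp) (auto intro!: AE_I2 simp: min_le_iff_disj)
  ultimately show ?thesis by (intro exI[of _ c]) simp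
qed

lemma bounded_exponents_real:
  assumes "p \<in> bounded_exponents M"
  shows "\<exists>r \<alpha> \<beta>. r \<in> borel_measurable M \<and> 0 < \<alpha> \<and> (\<forall>x. \<alpha> \<le> r x \<and> r x \<le> \<beta>) \<and>
    (AE x in M. p x = ennreal (r x))"
proof -
  have p: "p \<in> exponents M" "exp_sup M (space M) p < \<infinity>" using assms by (auto simp: bounded_exponents_def)
  then have [measurable]: "p \<in> borel_measurable M" by (simp add: exponents_def)
  obtain \<alpha> where \<alpha>: "0 < \<alpha>" "AE x in M. ennreal \<alpha> \<le> p x" using exponents_lower_bound[OF p(1)] by blast
  obtain b where b: "exp_sup M (space M) p = ennreal b" "0 \<le> b"
    using p(2) by (cases "exp_sup M (space M) p") auto
  have pb: "AE x in M. p x \<le> ennreal b" using exp_sup_AE[of "space M" M p] b(1)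
    by (auto elim: AE_mp)
  define \<beta> where "\<beta> = max b \<alpha>"
  define r where "r x = min (max (enn2real (p x)) \<alpha>) \<beta>" for x
  have "r \<in> borel_measurable M" unfolding r_def by measurable
  moreover have "\<forall>x. \<alpha> \<le> r x \<and> r x \<le> \<beta>" by (simp add: r_def \<beta>_def)
  moreover have "AE x in M. p x = ennreal (r x)" using \<alpha>(2) pb
  proof eventually_elim
    case (elim x)
    then obtain t where t: "p x = ennreal t" "0 \<le> t" by (cases "p x") (auto simp: top_unique)
    with elim b(2) \<alpha>(1) have "\<alpha> \<le> t" "t \<le> b" by (auto simp: ennreal_le_iff)
    then show ?case using t by (simp add: r_def \<beta>_def)
  qed
  ultimately show ?thesis using \<alpha>(1) by blast
qed

section \<open>Modulars and quasi-norms\<close>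

lemma ennreal_inverse_antimono: "x \<le> y \<Longrightarrow> inverse y \<le> inverse (x :: ennreal)"
  by (simp add: less_eq_ennreal.rep_eq inverse_ennreal.rep_eq ereal_inverse_antimono)

lemma divide_ennreal_antimono:
  assumes "l \<le> C"
  shows "a / ennreal C \<le> a / ennreal l"
  unfolding divide_ennreal_def using assms
  by (intro mult_left_mono ennreal_inverse_antimono ennreal_leI) auto

lemma ennpowr_mono: "t \<le> t' \<Longrightarrow> 0 \<le> \<rho> \<Longrightarrow> ennpowr t \<rho> \<le> ennpowr t' \<rho>"
  by (auto simp: ennpowr_def top_unique intro!: ennreal_leI powr_mono2 enn2real_mono less_top[THEN iffD1])

lemma phi_mono: "t \<le> t' \<Longrightarrow> phi p t \<le> phi p t'"
  by (auto simp: phi_def intro: ennpowr_mono)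

lemma phi_ennreal: "0 \<le> t \<Longrightarrow> 0 < \<rho> \<Longrightarrow> phi (ennreal \<rho>) (ennreal t) = ennreal (t powr \<rho>)"
  by (simp add: phi_def ennpowr_def)

lemma modular_mono: "(AE x in M. f x \<le> g x) \<Longrightarrow> modular M p f \<le> modular M p g"
  unfolding modular_def by (intro nn_integral_mono_AE) (auto intro: phi_mono)

lemma modular_le_one_of_Lp_norm_less:
  assumes "Lp_norm M p f < ennreal C"
  shows "modular M p (\<lambda>x. f x / ennreal C) \<le> 1"
proof -
  obtain l where l: "0 < l" "ennreal l < ennreal C" "modular M p (\<lambda>x. f x / ennreal l) \<le> 1"
    using assms unfolding Lp_norm_def Inf_less_iff by auto
  then have "l \<le> C" by (simp add: ennreal_less_iff)
  then have "modular M p (\<lambda>x. f x / ennreal C) \<le> modular M p (\<lambda>x. f x / ennreal l)"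
    by (intro modular_mono AE_I2 divide_ennreal_antimono)
  with l(3) show ?thesis by (rule order_trans[rotated])
qed

context variable_exponent
begin

text \<open>Since the exponents lie between two positive constants, dividing a function by a constant \<open>C \<ge> 1\<close>
  or \<open>l \<le> 1\<close> changes its modular by at most the factor \<open>C powr \<beta>\<close> or \<open>1 / l powr \<beta>\<close>. The next two
  lemmas translate between quasi-norms and modulars in this way.\<close>

lemma rmodular_le_of_modular:
  assumes pr: "AE x in M. p x = ennreal (r x)" and [measurable]: "f \<in> borel_measurable M"
    and C: "1 \<le> C" and le: "modular M p (\<lambda>x. f x / ennreal C) \<le> 1"
  shows "AE x in M. f x \<noteq> \<infinity>" and "rmodular (\<lambda>x. enn2real (f x)) \<le> ennreal (C powr \<beta>)"
proof -
  have top: "phi (ennreal (r x)) (f x / ennreal C) = \<infinity>" if "f x = \<infinity>" for x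
    using that by (simp add: phi_def ennpowr_def ennreal_top_divide)
  have "\<infinity> * emeasure M {x. f x = \<infinity>} = (\<integral>\<^sup>+x. \<infinity> * indicator {x. f x = \<infinity>} x \<partial>M)"
    using measurable_sets[of f M borel "{\<infinity>}"] by (subst nn_integral_cmult_indicator) (auto simp: vimage_def)
  also have "\<dots> \<le> modular M p (\<lambda>x. f x / ennreal C)" unfolding modular_def
  proof (rule nn_integral_mono_AE)
    show "AE x in M. \<infinity> * indicator {x. f x = \<infinity>} x \<le> phi (p x) (f x / ennreal C)"
      using pr
    proof eventually_elim
      case (elim x)
      then show ?case using top[of x] by (cases "f x = \<infinity>") auto
    qed
  qed
  finally have "\<infinity> * emeasure M {x. f x = \<infinity>} \<le> 1" using le by (rule order_trans)
  then have "emeasure M {x. f x = \<infinity>} = 0"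
    by (cases "emeasure M {x. f x = \<infinity>} = 0") (auto simp: ennreal_top_mult top_unique)
  moreover have "{x. f x = \<infinity>} \<in> sets M"
    using measurable_sets[of f M borel "{\<infinity>}"] by (auto simp: vimage_def)
  ultimately have "{x. f x = \<infinity>} \<in> null_sets M" by auto
  from AE_not_in[OF this] show fin: "AE x in M. f x \<noteq> \<infinity>" by simp
  have "ennreal (1 / C powr \<beta>) * rmodular (\<lambda>x. enn2real (f x)) =
      (\<integral>\<^sup>+x. ennreal (1 / C powr \<beta>) * ennreal (\<bar>enn2real (f x)\<bar> powr r x) \<partial>M)"
    unfolding rmodular_def by (subst nn_integral_cmult) auto
  also have "\<dots> \<le> modular M p (\<lambda>x. f x / ennreal C)" unfolding modular_def
  proof (rule nn_integral_mono_AE)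
    show "AE x in M. ennreal (1 / C powr \<beta>) * ennreal (\<bar>enn2real (f x)\<bar> powr r x) \<le> phi (p x) (f x / ennreal C)"
      using pr fin
    proof eventually_elim
      case (elim x)
      then obtain t where t: "f x = ennreal t" "0 \<le> t" by (cases "f x") auto
      have "1 / C powr \<beta> * t powr r x \<le> 1 / C powr r x * t powr r x"
        using C r_upper by (intro mult_right_mono divide_left_mono powr_mono mult_pos_pos) auto
      also have "\<dots> = (t / C) powr r x" using t C by (simp add: powr_divide)
      finally have "ennreal (1 / C powr \<beta> * t powr r x) \<le> ennreal ((t / C) powr r x)" by (rule ennreal_leI)
      also have "\<dots> = phi (p x) (f x / ennreal C)"
        using t C elim r_pos[of x] by (simp add: divide_ennreal phi_ennreal)
      finally show ?case using t C by (simp add: ennreal_mult[symmetric])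
    qed
  qed
  also have "\<dots> \<le> 1" by (rule le)
  finally have *: "ennreal (1 / C powr \<beta>) * rmodular (\<lambda>x. enn2real (f x)) \<le> 1" .
  have "rmodular (\<lambda>x. enn2real (f x)) =
      ennreal (C powr \<beta>) * (ennreal (1 / C powr \<beta>) * rmodular (\<lambda>x. enn2real (f x)))"
    using C by (simp add: mult.assoc[symmetric] ennreal_mult[symmetric])
  also have "\<dots> \<le> ennreal (C powr \<beta>) * 1" using * by (intro mult_left_mono) auto
  finally show "rmodular (\<lambda>x. enn2real (f x)) \<le> ennreal (C powr \<beta>)" by simp
qed

lemma Lp_norm_less_of_rmodular:
  assumes pr: "AE x in M. p x = ennreal (r x)" and fr: "AE x in M. f x = ennreal \<bar>g x\<bar>"
    and [measurable]: "g \<in> borel_measurable M"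
    and l: "0 < l" "l \<le> 1" "l < e" and le: "rmodular g \<le> ennreal (l powr \<beta>)"
  shows "Lp_norm M p f < ennreal e"
proof -
  have "modular M p (\<lambda>x. f x / ennreal l) \<le> (\<integral>\<^sup>+x. ennreal (1 / l powr \<beta>) * ennreal (\<bar>g x\<bar> powr r x) \<partial>M)"
    unfolding modular_def
  proof (rule nn_integral_mono_AE)
    show "AE x in M. phi (p x) (f x / ennreal l) \<le> ennreal (1 / l powr \<beta>) * ennreal (\<bar>g x\<bar> powr r x)"
      using pr fr
    proof eventually_elim
      case (elim x)
      have "phi (p x) (f x / ennreal l) = ennreal ((\<bar>g x\<bar> / l) powr r x)"
        using elim l r_pos[of x] by (simp add: divide_ennreal phi_ennreal)
      also have "(\<bar>g x\<bar> / l) powr r x = 1 / l powr r x * \<bar>g x\<bar> powr r x"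
        using l by (simp add: powr_divide)
      also have "ennreal \<dots> \<le> ennreal (1 / l powr \<beta> * \<bar>g x\<bar> powr r x)"
        using l r_upper by (intro ennreal_leI mult_right_mono divide_left_mono powr_le_one_exponent mult_pos_pos) auto
      also have "\<dots> = ennreal (1 / l powr \<beta>) * ennreal (\<bar>g x\<bar> powr r x)"
        using l by (intro ennreal_mult) auto
      finally show ?case .
    qed
  qed
  also have "\<dots> = ennreal (1 / l powr \<beta>) * rmodular g"
    unfolding rmodular_def by (intro nn_integral_cmult) measurable
  also have "\<dots> \<le> ennreal (1 / l powr \<beta>) * ennreal (l powr \<beta>)" using le by (intro mult_left_mono) auto
  also have "\<dots> = 1" using l by (simp add: ennreal_mult[symmetric])
  finally have "Lp_norm M p f \<le> ennreal l" unfolding Lp_norm_def using l by (intro Inf_lower) auto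
  also have "\<dots> < ennreal e" using l by (simp add: ennreal_less_iff)
  finally show ?thesis .
qed

end

section \<open>Bounds for single gradient components\<close>

lemma ellq_norm_ge:
  assumes "0 < q"
  shows "a k \<le> ellq_norm q a"
proof (cases "q = \<infinity>")
  case True
  then show ?thesis by (auto simp: ellq_norm_def intro: SUP_upper)
next
  case False
  define \<rho> where "\<rho> = enn2real q"
  have \<rho>: "0 < \<rho>" using assms False by (simp add: \<rho>_def enn2real_positive_iff less_top)
  have "(\<Sum>\<^sub>\<infinity>i\<in>{k}. ennpowr (a i) \<rho>) \<le> (\<Sum>\<^sub>\<infinity>i. ennpowr (a i) \<rho>)"
    by (intro infsum_mono_neutral nonneg_summable_on_complete) auto
  then have "ennpowr (ennpowr (a k) \<rho>) (1 / \<rho>) \<le> ellq_norm q a"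
    unfolding ellq_norm_def \<rho>_def[symmetric] using False \<rho> by (auto intro: ennpowr_mono)
  moreover have "ennpowr (ennpowr (a k) \<rho>) (1 / \<rho>) = a k"
    using \<rho> by (cases "a k") (auto simp: ennpowr_def powr_powr)
  ultimately show ?thesis by simp
qed

text \<open>A single component lies pointwise below the \<open>\<ell>\<^sup>q\<close>-norm of the sequence.\<close>

lemma M_seminorm_gradient:
  assumes "M_seminorm M s p q u < ennreal C" and q: "\<And>x. 0 < q x"
  shows "\<exists>g\<in>gradients M s u. \<forall>k. modular M p (\<lambda>x. g k x / ennreal C) \<le> 1"
proof -
  obtain g where g: "g \<in> gradients M s u" "Lp_ellq_norm M p q g < ennreal C"
    using assms(1) unfolding M_seminorm_def INF_less_iff by blast
  have "modular M p (\<lambda>x. ellq_norm (q x) (\<lambda>k. g k x) / ennreal C) \<le> 1"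
    using g(2) unfolding Lp_ellq_norm_def by (rule modular_le_one_of_Lp_norm_less)
  moreover have "modular M p (\<lambda>x. g k x / ennreal C) \<le>
      modular M p (\<lambda>x. ellq_norm (q x) (\<lambda>k. g k x) / ennreal C)" for k
    using ellq_norm_ge[OF q, of "\<lambda>k. g k _"]
    by (intro modular_mono AE_I2 divide_right_mono_ennreal)
  ultimately show ?thesis using g(1) order_trans by blast
qed

text \<open>Each term of the series in the definition of the modular of \<open>\<ell>\<^sup>q(L\<^sup>p)\<close> is at most \<open>1 < 2\<close>, and
  \<open>2\<^sup>1\<^sup>/\<^sup>q\<close> is bounded because \<open>q\<close> is bounded away from \<open>0\<close>.\<close>

lemma N_seminorm_gradient:
  assumes "N_seminorm M s p q u < ennreal C" and C: "0 < C" and c: "0 < c" "AE x in M. ennreal c \<le> q x"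
  shows "\<exists>g\<in>gradients M s u. \<forall>k. modular M p (\<lambda>x. g k x / ennreal (C * 2 powr (1 / c))) \<le> 1"
proof -
  obtain g where g: "g \<in> gradients M s u" "ellq_Lp_norm M p q g < ennreal C"
    using assms(1) unfolding N_seminorm_def INF_less_iff by blast
  obtain m where m: "0 < m" "ennreal m < ennreal C"
    and mod: "ellq_Lp_modular M p q (\<lambda>k x. g k x / ennreal m) \<le> 1"
    using g(2) unfolding ellq_Lp_norm_def Inf_less_iff by auto
  have mC: "m \<le> C" using m by (simp add: ennreal_less_iff)
  have "modular M p (\<lambda>x. g k x / ennreal (C * 2 powr (1 / c))) \<le> 1" for k
  proof -
    define I where "I k = Inf {ennreal l | l. 0 < l \<and>
      modular M p (\<lambda>x. g k x / ennreal m / ennreal (l powr enn2real (inverse (q x)))) \<le> 1}" for k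
    have "(\<Sum>\<^sub>\<infinity>i\<in>{k}. I i) \<le> (\<Sum>\<^sub>\<infinity>i. I i)"
      by (intro infsum_mono_neutral nonneg_summable_on_complete) auto
    also have "\<dots> \<le> 1" using mod unfolding ellq_Lp_modular_def I_def .
    finally have "I k \<le> 1" by simp
    also have "1 < ennreal 2" by simp
    finally obtain l where l: "0 < l" "ennreal l < ennreal 2"
      and le: "modular M p (\<lambda>x. g k x / ennreal m / ennreal (l powr enn2real (inverse (q x)))) \<le> 1"
      unfolding I_def Inf_less_iff by auto
    have "l \<le> 2" using l by (simp add: ennreal_less_iff)
    have "modular M p (\<lambda>x. g k x / ennreal (C * 2 powr (1 / c))) \<le>
      modular M p (\<lambda>x. g k x / ennreal m / ennreal (l powr enn2real (inverse (q x))))"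
    proof (rule modular_mono)
      show "AE x in M. g k x / ennreal (C * 2 powr (1 / c)) \<le>
          g k x / ennreal m / ennreal (l powr enn2real (inverse (q x)))"
        using c(2)
      proof eventually_elim
        case (elim x)
        define \<rho> where "\<rho> = enn2real (inverse (q x))"
        have "inverse (q x) \<le> inverse (ennreal c)" using elim by (rule ennreal_inverse_antimono)
        also have "\<dots> = ennreal (1 / c)" using c by (simp add: inverse_ennreal inverse_eq_divide)
        finally have "\<rho> \<le> 1 / c" unfolding \<rho>_def using c by (intro enn2real_leI) auto
        moreover have "0 \<le> \<rho>" by (simp add: \<rho>_def)
        ultimately have "l powr \<rho> \<le> 2 powr (1 / c)"
          using l \<open>l \<le> 2\<close> by (intro powr_le_of_ge_one) auto
        then have "m * l powr \<rho> \<le> C * 2 powr (1 / c)" using m mC by (intro mult_mono) auto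
        then have "g k x / ennreal (C * 2 powr (1 / c)) \<le> g k x / ennreal (m * l powr \<rho>)"
          by (rule divide_ennreal_antimono)
        also have "\<dots> = g k x / ennreal m / ennreal (l powr \<rho>)"
        proof -
          have "inverse (ennreal (m * l powr \<rho>)) = inverse (ennreal m) * inverse (ennreal (l powr \<rho>))"
            using m l by (simp add: inverse_ennreal ennreal_mult[symmetric])
          then show ?thesis by (simp add: divide_ennreal_def mult.assoc)
        qed
        finally show ?case unfolding \<rho>_def .
      qed
    qed
    with le show ?thesis by (rule order_trans[rotated])
  qed
  with g(1) show ?thesis by blast
qed

section \<open>Total boundedness in the quasi-normed space\<close>

lemma e2ennreal_abs_diff:
  assumes "\<bar>a\<bar> \<noteq> \<infinity>" "\<bar>b\<bar> \<noteq> (\<infinity>::ereal)"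
  shows "e2ennreal \<bar>a - b\<bar> = ennreal \<bar>real_of_ereal a - real_of_ereal b\<bar>"
  using assms by (cases a; cases b) auto

context variable_exponent
begin

text \<open>At distances below \<open>1\<close> a power of the distance increases when its exponent is replaced by the
  lower bound \<open>\<sigma>0\<close>. Small scales suffice, so only the components with index \<open>k \<ge> 0\<close> are kept.\<close>

lemma real_gradient:
  assumes pr: "AE x in M. p x = ennreal (r x)"
    and sr: "AE x in M. s x = ennreal (\<sigma> x)" and \<sigma>: "0 < \<sigma>0" "\<And>x. \<sigma>0 \<le> \<sigma> x"
    and u: "AE x in M. \<bar>u x\<bar> \<noteq> \<infinity>" and g: "g \<in> gradients M s u"
    and C: "1 \<le> C" and mod: "\<And>k. modular M p (\<lambda>x. g k x / ennreal C) \<le> 1"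
  shows "\<exists>g' :: nat \<Rightarrow> 'a \<Rightarrow> real.
      (\<forall>k. g' k \<in> borel_measurable M \<and> (\<forall>x. 0 \<le> g' k x) \<and> rmodular (g' k) \<le> ennreal (C powr \<beta>)) \<and>
      (\<exists>N\<in>null_sets M. \<forall>k. \<forall>x\<in>-N. \<forall>y\<in>-N. (1/2) ^ Suc k \<le> dist x y \<and> dist x y < (1/2) ^ k \<longrightarrow>
        \<bar>real_of_ereal (u x) - real_of_ereal (u y)\<bar>
          \<le> ((1/2) powr \<sigma>0) ^ k * g' k x + ((1/2) powr \<sigma>0) ^ k * g' k y)"
proof -
  have gm [measurable]: "g k \<in> borel_measurable M" for k using g by (simp add: gradients_def)
  obtain N where N: "N \<in> null_sets M" and gN: "\<forall>k. \<forall>x\<in>-N. \<forall>y\<in>-N.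
        2 powr (- real_of_int k - 1) \<le> dist x y \<and> dist x y < 2 powr (- real_of_int k) \<longrightarrow>
        e2ennreal \<bar>u x - u y\<bar> \<le>
          ennreal (dist x y powr enn2real (s x)) * g k x +
          ennreal (dist x y powr enn2real (s y)) * g k y"
    using g unfolding gradients_def by blast
  define g' where "g' k x = enn2real (g (int k) x)" for k :: nat and x
  have "AE x in M. \<forall>k. g k x \<noteq> \<infinity>"
    using rmodular_le_of_modular(1)[OF pr gm C mod] by (subst AE_all_countable) simp
  then have "AE x in M. x \<notin> N \<and> s x = ennreal (\<sigma> x) \<and> \<bar>u x\<bar> \<noteq> \<infinity> \<and> (\<forall>k. g k x \<noteq> \<infinity>)"
    using AE_not_in[OF N] sr u by eventually_elim simp
  then obtain N2 where N2: "N2 \<in> null_sets M"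
    and good: "\<And>x. x \<notin> N2 \<Longrightarrow> x \<notin> N \<and> s x = ennreal (\<sigma> x) \<and> \<bar>u x\<bar> \<noteq> \<infinity> \<and> (\<forall>k. g k x \<noteq> \<infinity>)"
    by (rule AE_null_setE) blast
  have "\<bar>real_of_ereal (u x) - real_of_ereal (u y)\<bar>
          \<le> ((1/2) powr \<sigma>0) ^ k * g' k x + ((1/2) powr \<sigma>0) ^ k * g' k y"
    if xy: "x \<notin> N2" "y \<notin> N2" "(1/2) ^ Suc k \<le> dist x y" "dist x y < (1/2) ^ k" for k x y
  proof -
    let ?\<theta> = "(1/2) powr \<sigma>0"
    have half: "(1/2::real) ^ j = 2 powr (- real j)" for j
      by (simp add: powr_minus powr_realpow power_one_over inverse_eq_divide)
    have sc: "2 powr (- real_of_int (int k) - 1) \<le> dist x y" "dist x y < 2 powr (- real_of_int (int k))"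
    proof -
      have "- real (Suc k) = - real_of_int (int k) - 1" by simp
      then show "2 powr (- real_of_int (int k) - 1) \<le> dist x y" using xy(3) half[of "Suc k"] by metis
      show "dist x y < 2 powr (- real_of_int (int k))" using xy(4) half[of k] by simp
    qed
    have coeff: "dist x y powr enn2real (s z) \<le> ?\<theta> ^ k" if "z \<notin> N2" for z
    proof -
      have "dist x y powr \<sigma> z \<le> ((1/2) ^ k) powr \<sigma> z"
        using xy(4) \<sigma>(1) \<sigma>(2)[of z] by (intro powr_mono2) auto
      also have "\<dots> \<le> ((1/2) ^ k) powr \<sigma>0"
        using \<sigma>(2)[of z] by (intro powr_le_one_exponent) (auto intro: power_le_one)
      also have "\<dots> = ?\<theta> ^ k"
        by (simp add: powr_power powr_realpow[symmetric] powr_powr mult.commute)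
      finally show ?thesis using good[OF that] \<sigma>(1) \<sigma>(2)[of z] by simp
    qed
    have "ennreal \<bar>real_of_ereal (u x) - real_of_ereal (u y)\<bar> = e2ennreal \<bar>u x - u y\<bar>"
      using good[OF xy(1)] good[OF xy(2)] by (simp add: e2ennreal_abs_diff)
    also have "\<dots> \<le> ennreal (dist x y powr enn2real (s x)) * g (int k) x +
          ennreal (dist x y powr enn2real (s y)) * g (int k) y"
      using gN good[OF xy(1)] good[OF xy(2)] sc by blast
    also have "\<dots> \<le> ennreal (?\<theta> ^ k) * g (int k) x + ennreal (?\<theta> ^ k) * g (int k) y"
      using coeff xy(1,2) by (intro add_mono mult_right_mono ennreal_leI) auto
    also have "\<dots> = ennreal (?\<theta> ^ k) * ennreal (g' k x) + ennreal (?\<theta> ^ k) * ennreal (g' k y)"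
      using good[OF xy(1)] good[OF xy(2)] by (simp add: g'_def less_top[symmetric])
    also have "\<dots> = ennreal (?\<theta> ^ k * g' k x + ?\<theta> ^ k * g' k y)"
      by (simp add: g'_def ennreal_mult ennreal_plus)
    finally show ?thesis by (subst (asm) ennreal_le_iff) (auto simp: g'_def)
  qed
  moreover have "g' k \<in> borel_measurable M \<and> (\<forall>x. 0 \<le> g' k x) \<and> rmodular (g' k) \<le> ennreal (C powr \<beta>)" for k
    using rmodular_le_of_modular(2)[OF pr gm C mod] unfolding g'_def by simp
  ultimately show ?thesis using N2 by (intro exI[of _ g'] conjI bexI[of _ N2]) auto
qed

text \<open>Domination is left as the hypothesis \<open>dom\<close>, because it is the one step in which totally bounded
  spaces and integrable measures are treated differently.\<close>

lemma qn_totally_boundedI: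
  assumes pr: "AE x in M. p x = ennreal (r x)"
    and sr: "AE x in M. s x = ennreal (\<sigma> x)" and \<sigma>: "0 < \<sigma>0" "\<And>x. \<sigma>0 \<le> \<sigma> x"
    and dom: "\<And>W L. W \<subseteq> borel_measurable M \<Longrightarrow> equi_oscillating W \<Longrightarrow> 0 \<le> L \<Longrightarrow>
      (\<And>w. w \<in> W \<Longrightarrow> rmodular w \<le> ennreal L) \<Longrightarrow> equi_dominated W"
    and S: "S \<subseteq> Lp_space M p" and C: "1 \<le> C" "\<And>u. u \<in> S \<Longrightarrow> Lp_norm M p (eabs u) < ennreal C"
    and grad: "\<And>u. u \<in> S \<Longrightarrow> \<exists>g\<in>gradients M s u. \<forall>k. modular M p (\<lambda>x. g k x / ennreal C) \<le> 1"
  shows "qn_totally_bounded (L_qnspace M p) S"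
proof -
  define W where "W = (\<lambda>u x. real_of_ereal (u x)) ` S"
  have um: "u \<in> borel_measurable M" if "u \<in> S" for u using S that by (auto simp: Lp_space_def)
  have bound: "(AE x in M. \<bar>u x\<bar> \<noteq> \<infinity>) \<and> rmodular (\<lambda>x. real_of_ereal (u x)) \<le> ennreal (C powr \<beta>)"
    if u: "u \<in> S" for u
  proof -
    have [measurable]: "u \<in> borel_measurable M" using um[OF u] .
    have em: "eabs u \<in> borel_measurable M" unfolding eabs_def by measurable
    note b = rmodular_le_of_modular[OF pr em C(1) modular_le_one_of_Lp_norm_less[OF C(2)[OF u]]]
    have "eabs u x = \<infinity> \<longleftrightarrow> \<bar>u x\<bar> = \<infinity>" for x by (cases "u x") (auto simp: eabs_def)
    then have fin: "AE x in M. \<bar>u x\<bar> \<noteq> \<infinity>" using b(1) by simp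
    have "\<bar>enn2real (eabs u x)\<bar> = \<bar>real_of_ereal (u x)\<bar>" if "\<bar>u x\<bar> \<noteq> \<infinity>" for x
      using that by (cases "u x") (auto simp: eabs_def)
    then have "rmodular (\<lambda>x. real_of_ereal (u x)) = rmodular (\<lambda>x. enn2real (eabs u x))"
      unfolding rmodular_def using fin by (intro nn_integral_cong_AE) (auto elim: AE_mp)
    with b(2) fin show ?thesis by simp
  qed
  have W: "W \<subseteq> borel_measurable M" using um by (auto simp: W_def)
  have osc: "equi_oscillating W"
  proof (rule equi_oscillatingI)
    show "0 < (1/2) powr \<sigma>0" by simp
    show "(1/2::real) powr \<sigma>0 < 1" using powr_less_mono2[of \<sigma>0 "1/2" 1] \<sigma>(1) by simp
    show "0 \<le> C powr \<beta>" by simp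
    fix w assume "w \<in> W"
    then obtain u where u: "u \<in> S" "w = (\<lambda>x. real_of_ereal (u x))" by (auto simp: W_def)
    obtain g where g: "g \<in> gradients M s u" "\<And>k. modular M p (\<lambda>x. g k x / ennreal C) \<le> 1"
      using grad[OF u(1)] by blast
    show "\<exists>g :: nat \<Rightarrow> 'a \<Rightarrow> real.
      (\<forall>k. g k \<in> borel_measurable M \<and> (\<forall>x. 0 \<le> g k x) \<and> rmodular (g k) \<le> ennreal (C powr \<beta>)) \<and>
      (\<exists>N\<in>null_sets M. \<forall>k. \<forall>x\<in>-N. \<forall>y\<in>-N. (1/2) ^ Suc k \<le> dist x y \<and> dist x y < (1/2) ^ k \<longrightarrow>
        \<bar>w x - w y\<bar> \<le> ((1/2) powr \<sigma>0) ^ k * g k x + ((1/2) powr \<sigma>0) ^ k * g k y)"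
      unfolding u(2) using bound[OF u(1)] by (intro real_gradient[OF pr sr \<sigma> _ g(1) C(1) g(2)]) simp
  qed
  have "rmodular w \<le> ennreal (C powr \<beta>)" if "w \<in> W" for w using that bound by (auto simp: W_def)
  then have ed: "equi_dominated W" using W osc by (intro dom[of W "C powr \<beta>"]) auto
  show ?thesis unfolding qn_totally_bounded_def L_qnspace_def fst_conv snd_conv
  proof (intro conjI allI impI)
    show "S \<subseteq> Lp_space M p" by (rule S)
    fix e :: real assume e: "0 < e"
    define l where "l = min 1 (e / 2)"
    have l: "0 < l" "l \<le> 1" "l < e" using e by (auto simp: l_def)
    have "0 < l powr \<beta>" using l by simp
    from totally_bounded_modular[OF W osc ed this] obtain V where V: "finite V" "V \<subseteq> borel_measurable M"
      "\<forall>v\<in>V. rmodular v < \<infinity>" "\<forall>w\<in>W. \<exists>v\<in>V. rmodular (\<lambda>x. w x - v x) \<le> ennreal (l powr \<beta>)"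
      by (elim exE conjE)
    define F where "F = (\<lambda>v x. ereal (v x)) ` V"
    have "F \<subseteq> Lp_space M p"
    proof
      fix f assume "f \<in> F"
      then obtain v where v: "v \<in> V" "f = (\<lambda>x. ereal (v x))" by (auto simp: F_def)
      then have [measurable]: "v \<in> borel_measurable M" using V(2) by auto
      have "modular M p (\<lambda>x. ennreal 1 * eabs f x) = rmodular v"
        unfolding modular_def rmodular_def
      proof (rule nn_integral_cong_AE)
        show "AE x in M. phi (p x) (ennreal 1 * eabs f x) = ennreal (\<bar>v x\<bar> powr r x)"
          using pr by eventually_elim (simp add: eabs_def v(2) phi_ennreal r_pos)
      qed
      also have "\<dots> < \<infinity>" using V(3) v(1) by blast
      finally have "\<exists>l>0. modular M p (\<lambda>x. ennreal l * eabs f x) < \<infinity>"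
        by (intro exI[of _ 1]) simp
      then show "f \<in> Lp_space M p" unfolding Lp_space_def by (simp add: v(2))
    qed
    moreover have "\<exists>f\<in>F. Lp_norm M p (eabs (\<lambda>x. u x - f x)) < ennreal e" if u: "u \<in> S" for u
    proof -
      have [measurable]: "u \<in> borel_measurable M" using um[OF u] .
      have "(\<lambda>x. real_of_ereal (u x)) \<in> W" using u by (simp add: W_def)
      from bspec[OF V(4) this] obtain v where v: "v \<in> V"
        "rmodular (\<lambda>x. real_of_ereal (u x) - v x) \<le> ennreal (l powr \<beta>)" by (elim bexE)
      have [measurable]: "v \<in> borel_measurable M" using V(2) v(1) by auto
      have "AE x in M. eabs (\<lambda>x. u x - ereal (v x)) x = ennreal \<bar>real_of_ereal (u x) - v x\<bar>"
        using conjunct1[OF bound[OF u]] by eventually_elim (simp add: eabs_def e2ennreal_abs_diff)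
      then have "Lp_norm M p (eabs (\<lambda>x. u x - ereal (v x))) < ennreal e"
        using v(2) l by (intro Lp_norm_less_of_rmodular[OF pr]) auto
      then show ?thesis using v(1) by (auto simp: F_def)
    qed
    ultimately show "\<exists>F. finite F \<and> F \<subseteq> Lp_space M p \<and>
        (\<forall>u\<in>S. \<exists>v\<in>F. Lp_norm M p (eabs (\<lambda>x. u x - v x)) < ennreal e)"
      using V(1) by (intro exI[of _ F] conjI ballI) (auto simp: F_def)
  qed
qed

end

section \<open>Consequences of the log-Hoelder conditions\<close>

text \<open>For \<open>b < a\<close> this is Young's inequality in the form \<open>l * z \<le> A powr (1/\<tau>) * A powr (1/a)\<close>, where
  \<open>1/\<tau> = 1/b - 1/a\<close>; for \<open>a \<le> b\<close> the power only decreases, as \<open>l * z \<le> 1\<close>.\<close>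

lemma powr_change_exponent:
  fixes z l A a b :: real
  assumes "0 < a" "0 < b" "0 \<le> z" "z \<le> 1" "0 < l" "l \<le> 1" and zA: "z powr a \<le> A"
    and lA: "1 / a < 1 / b \<Longrightarrow> l powr (1 / (1 / b - 1 / a)) \<le> A"
  shows "(l * z) powr b \<le> A"
proof (cases "a \<le> b")
  case True
  have "l * z \<le> 1 * z" using assms by (intro mult_right_mono) auto
  then have "(l * z) powr b \<le> z powr b" using assms by (intro powr_mono2) auto
  also have "\<dots> \<le> z powr a" using True assms by (intro powr_le_one_exponent) auto
  finally show ?thesis using zA by simp
next
  case False
  define t where "t = 1 / b - 1 / a"
  have t: "0 < t" using False assms(1,2) by (simp add: t_def field_simps)
  then have lt: "l powr (1 / t) \<le> A" using lA by (simp add: t_def)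
  have "0 < l powr (1 / t)" using assms by simp
  with lt have A: "0 < A" by linarith
  have "l = (l powr (1 / t)) powr t" using t assms by (simp add: powr_powr)
  also have "\<dots> \<le> A powr t" using lt t by (intro powr_mono2) auto
  finally have "l \<le> A powr t" .
  moreover have "z \<le> A powr (1 / a)"
  proof -
    have "z = (z powr a) powr (1 / a)" using assms by (simp add: powr_powr)
    also have "\<dots> \<le> A powr (1 / a)" using zA assms by (intro powr_mono2) auto
    finally show ?thesis .
  qed
  ultimately have "l * z \<le> A powr t * A powr (1 / a)" using assms by (intro mult_mono) auto
  also have "\<dots> = A powr (1 / b)" by (simp add: powr_add[symmetric] t_def)
  finally have "(l * z) powr b \<le> (A powr (1 / b)) powr b" using assms by (intro powr_mono2) auto
  also have "\<dots> = A" using A assms by (simp add: powr_powr)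
  finally show ?thesis .
qed

context variable_exponent
begin

text \<open>Outside a null set the values of the exponent in a ball lie between its essential bounds on the
  ball, so that the condition on the essential bounds becomes one on pairs of points.\<close>

lemma log_exponents_holder:
  assumes pr: "AE x in M. p x = ennreal (r x)" and p: "p \<in> log_exponents M"
  shows "\<exists>C1\<ge>1. \<forall>a d. 0 < d \<longrightarrow> (\<exists>N\<in>null_sets M. \<forall>x\<in>ball a d - N. \<forall>y\<in>ball a d - N.
      measure M (ball a d) \<le> 1 \<longrightarrow> measure M (ball a d) powr (1 / r x - 1 / r y) \<le> C1)"
proof -
  obtain C where C: "\<And>x d. 0 < d \<Longrightarrow>
        measure M (ball x d) powr (enn2real (inverse (exp_sup M (ball x d) p))
                                 - enn2real (inverse (exp_inf M (ball x d) p))) \<le> C"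
    using p unfolding log_exponents_def by blast
  have "\<exists>N\<in>null_sets M. \<forall>x\<in>ball a d - N. \<forall>y\<in>ball a d - N.
      measure M (ball a d) \<le> 1 \<longrightarrow> measure M (ball a d) powr (1 / r x - 1 / r y) \<le> max 1 C"
    if d: "0 < d" for a d
  proof -
    define B where "B = ball a d"
    have B: "B \<in> sets M" by (simp add: B_def)
    have "AE x in M. p x = ennreal (r x) \<and> (x \<in> B \<longrightarrow> exp_inf M B p \<le> p x \<and> p x \<le> exp_sup M B p)"
      using pr exp_inf_AE[OF B, of p] exp_sup_AE[OF B, of p] by eventually_elim auto
    then obtain N where N: "N \<in> null_sets M"
      and good: "\<And>x. x \<notin> N \<Longrightarrow> p x = ennreal (r x) \<and> (x \<in> B \<longrightarrow> exp_inf M B p \<le> p x \<and> p x \<le> exp_sup M B p)"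
      by (rule AE_null_setE) blast
    have inv: "inverse (ennreal (r x)) = ennreal (1 / r x)" for x
      using r_pos by (simp add: inverse_ennreal inverse_eq_divide)
    have "AE x in M. ennreal \<alpha> \<le> p x" using pr by eventually_elim (simp add: ennreal_leI r_lower)
    then have "ennreal \<alpha> \<le> exp_inf M B p" by (intro exp_inf_geI[OF B])
    then have infpos: "exp_inf M B p \<noteq> 0" using \<alpha>_pos by (auto simp: ennreal_eq_0_iff)
    have up: "enn2real (inverse (exp_sup M B p)) \<le> 1 / r x" if "x \<in> B - N" for x
    proof -
      have "inverse (exp_sup M B p) \<le> ennreal (1 / r x)"
        using good[of x] that unfolding inv[symmetric] by (auto intro: ennreal_inverse_antimono)
      then show ?thesis using r_pos[of x] by (intro enn2real_leI) auto
    qed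
    have low: "1 / r x \<le> enn2real (inverse (exp_inf M B p))" if "x \<in> B - N" for x
    proof -
      have "ennreal (1 / r x) \<le> inverse (exp_inf M B p)"
        using good[of x] that unfolding inv[symmetric] by (auto intro: ennreal_inverse_antimono)
      then have "enn2real (ennreal (1 / r x)) \<le> enn2real (inverse (exp_inf M B p))"
        using infpos by (intro enn2real_mono) (auto simp: less_top[symmetric])
      then show ?thesis using r_pos[of x] by simp
    qed
    have "measure M B powr (1 / r x - 1 / r y) \<le> max 1 C"
      if "x \<in> B - N" "y \<in> B - N" "measure M B \<le> 1" for x y
    proof -
      have "measure M B powr (1 / r x - 1 / r y) \<le>
        measure M B powr (enn2real (inverse (exp_sup M B p)) - enn2real (inverse (exp_inf M B p)))"
        using up[OF that(1)] low[OF that(2)] that(3) by (intro powr_le_one_exponent) auto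
      also have "\<dots> \<le> C" unfolding B_def by (rule C[OF d])
      finally show ?thesis by simp
    qed
    then show ?thesis unfolding B_def[symmetric] using N by blast
  qed
  then show ?thesis by (intro exI[of _ "max 1 C"]) auto
qed

text \<open>A bound for a power of \<open>z \<le> 1\<close> with the exponent at \<open>y\<close> passes first to the limit exponent and from
  there to the exponent at \<open>x\<close>. Each step costs a factor \<open>l\<close> and the value of \<open>h = l powr \<tau>\<close> at
  \<open>y\<close> or at \<open>x\<close>, and \<open>h\<close> is integrable because the constant \<open>1\<close> belongs to the Lebesgue space with
  exponent \<open>\<tau>\<close>. If the limit exponent is infinite, then \<open>\<tau>\<close> is the exponent itself, and
  \<open>h x\<close> alone is a bound.\<close>

lemma log_exponents_decay:
  assumes pr: "AE x in M. p x = ennreal (r x)" and p: "p \<in> log_exponents M"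
  shows "\<exists>h \<kappa>. h \<in> borel_measurable M \<and> (\<forall>x. 0 \<le> h x) \<and> (\<integral>\<^sup>+x. ennreal (h x) \<partial>M) < \<infinity> \<and>
    0 < \<kappa> \<and> \<kappa> \<le> (1::real) \<and> (\<forall>x y z c. 0 \<le> z \<longrightarrow> z \<le> 1 \<longrightarrow> z powr r y \<le> c \<longrightarrow> h y \<le> c \<longrightarrow>
      (\<kappa> * z) powr r x \<le> c + h x)"
proof -
  obtain p_inf where tau: "(\<lambda>_. 1) \<in> Lp_space M (\<lambda>x.
        inverse (ennreal \<bar>enn2real (inverse (p x)) - enn2real (inverse p_inf)\<bar>))"
    using p unfolding log_exponents_def by blast
  define t where "t = enn2real (inverse p_inf)"
  have t: "0 \<le> t" by (simp add: t_def)
  obtain l0 where l0: "0 < l0" and fin: "modular M (\<lambda>x. inverse (ennreal \<bar>enn2real (inverse (p x)) - t\<bar>))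
      (\<lambda>x. ennreal l0 * eabs (\<lambda>_. 1) x) < \<infinity>"
    using tau unfolding Lp_space_def t_def by blast
  define l where "l = min l0 1"
  have l: "0 < l" "l \<le> 1" "l \<le> l0" using l0 by (auto simp: l_def)
  define h where "h x = (if 1 / r x = t then 0 else l powr (1 / \<bar>1 / r x - t\<bar>))" for x
  have hm: "h \<in> borel_measurable M" unfolding h_def by measurable
  have h0: "0 \<le> h x" for x by (simp add: h_def)
  have "(\<integral>\<^sup>+x. ennreal (h x) \<partial>M) \<le> modular M (\<lambda>x. inverse (ennreal \<bar>enn2real (inverse (p x)) - t\<bar>))
      (\<lambda>x. ennreal l0 * eabs (\<lambda>_. 1) x)"
    unfolding modular_def
  proof (rule nn_integral_mono_AE)
    show "AE x in M. ennreal (h x) \<le> phi (inverse (ennreal \<bar>enn2real (inverse (p x)) - t\<bar>))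
        (ennreal l0 * eabs (\<lambda>_. 1) x)"
      using pr
    proof eventually_elim
      case (elim x)
      have e1: "eabs (\<lambda>_. 1) x = 1" by (simp add: eabs_def one_ereal_def)
      have px: "enn2real (inverse (p x)) = 1 / r x"
        using elim r_pos[of x] by (simp add: inverse_ennreal inverse_eq_divide)
      show ?case
      proof (cases "1 / r x = t")
        case True
        then show ?thesis by (simp add: h_def)
      next
        case False
        define c where "c = \<bar>1 / r x - t\<bar>"
        have c: "0 < c" using False by (simp add: c_def)
        have "h x \<le> l0 powr (1 / c)" using False l c by (auto simp: h_def c_def intro!: powr_mono2)
        then have "ennreal (h x) \<le> phi (ennreal (1 / c)) (ennreal l0)"
          using c l0 by (simp add: phi_ennreal ennreal_leI)
        moreover have "inverse (ennreal c) = ennreal (1 / c)"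
          using c by (simp add: inverse_ennreal inverse_eq_divide)
        ultimately show ?thesis unfolding px e1 c_def by simp
      qed
    qed
  qed
  then have hint: "(\<integral>\<^sup>+x. ennreal (h x) \<partial>M) < \<infinity>" using fin by (rule le_less_trans)
  have decay: "(l * l * z) powr r x \<le> c + h x"
    if z: "0 \<le> z" "z \<le> 1" "z powr r y \<le> c" "h y \<le> c" for x y z c
  proof -
    have c: "0 \<le> c" using z(3) powr_ge_zero[of z "r y"] by linarith
    have lz: "0 \<le> l * z" "l * z \<le> 1" using l z by (auto intro: mult_le_one)
    show ?thesis
    proof (cases "t = 0")
      case True
      have "1 / r x \<noteq> t" "\<bar>1 / r x - t\<bar> = 1 / r x" using True r_pos[of x] by auto
      then have hx: "h x = l powr r x" by (simp add: h_def)
      have "l * (l * z) \<le> l * 1" using l lz by (intro mult_left_mono) auto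
      then have "(l * l * z) powr r x \<le> l powr r x"
        using l z r_pos[of x] by (intro powr_mono2) (auto simp: mult.assoc)
      then show ?thesis using c hx by simp
    next
      case False
      define P where "P = 1 / t"
      have P: "0 < P" "1 / P = t" using False t by (auto simp: P_def)
      have "(l * z) powr P \<le> c"
      proof (rule powr_change_exponent[OF r_pos[of y] P(1) z(1,2) l(1,2) z(3)])
        assume "1 / r y < 1 / P"
        then show "l powr (1 / (1 / P - 1 / r y)) \<le> c" using z(4) P by (simp add: h_def)
      qed
      then have "(l * z) powr P \<le> c + h x" using h0[of x] by linarith
      then have "(l * (l * z)) powr r x \<le> c + h x"
      proof (rule powr_change_exponent[OF P(1) r_pos[of x] lz l(1,2)])
        assume "1 / P < 1 / r x"
        then show "l powr (1 / (1 / r x - 1 / P)) \<le> c + h x" using c P by (simp add: h_def)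
      qed
      then show ?thesis by (simp add: mult.assoc)
    qed
  qed
  have "0 < l * l" "l * l \<le> 1" using l by (auto intro: mult_le_one)
  then show ?thesis using hm h0 hint decay
    by (intro exI[of _ h] exI[of _ "l * l"] conjI allI impI)
qed

end

section \<open>The compact embeddings\<close>

lemma qn_continuous_inclusionI:
  assumes "fst Y \<subseteq> fst Z" "\<And>u. snd Z u \<le> snd Y u"
  shows "qn_continuous_inclusion Y Z"
  unfolding qn_continuous_inclusion_def using assms by (meson le_less_trans)

theorem theorem3p2:
  fixes \<mu> :: "'a::metric_space measure"
    and p q s :: "'a \<Rightarrow> ennreal"
  assumes "metric_measure_space \<mu>"
    and "p \<in> bounded_exponents \<mu>" and "s \<in> bounded_exponents \<mu>" and "q \<in> exponents \<mu>"
    and "totally_bounded (UNIV :: 'a set) \<or> (integrable_measure \<mu> \<and> p \<in> log_exponents \<mu>)"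
  shows "M_qnspace \<mu> s p q \<hookrightarrow>\<hookrightarrow> L_qnspace \<mu> p \<and> N_qnspace \<mu> s p q \<hookrightarrow>\<hookrightarrow> L_qnspace \<mu> p"
proof -
  have mm: "metric_measure \<mu>"
    using assms(1) by (auto simp: metric_measure_space_def metric_measure_def)
  then have sp: "space \<mu> = UNIV" by (rule metric_measure.space_eq)
  obtain r \<alpha> \<beta> where r: "r \<in> borel_measurable \<mu>" "0 < \<alpha>" "\<forall>x. \<alpha> \<le> r x \<and> r x \<le> \<beta>"
    and pr: "AE x in \<mu>. p x = ennreal (r x)"
    using bounded_exponents_real[OF assms(2)] by blast
  obtain \<sigma> \<sigma>0 \<sigma>1 where \<sigma>: "0 < \<sigma>0" "\<forall>x. \<sigma>0 \<le> \<sigma> x \<and> \<sigma> x \<le> \<sigma>1"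
    and sr: "AE x in \<mu>. s x = ennreal (\<sigma> x)"
    using bounded_exponents_real[OF assms(3)] by blast
  obtain c where c: "0 < c" "AE x in \<mu>. ennreal c \<le> q x"
    using exponents_lower_bound[OF assms(4)] by blast
  have q: "0 < q x" for x using assms(4) sp by (simp add: exponents_def)
  interpret variable_exponent \<mu> r \<alpha> \<beta>
    using mm r by (auto simp: variable_exponent_def variable_exponent_axioms_def)
  have dom: "equi_dominated W"
    if W: "W \<subseteq> borel_measurable \<mu>" "equi_oscillating W" "0 \<le> L" "\<And>w. w \<in> W \<Longrightarrow> rmodular w \<le> ennreal L"
    for W L
  proof (cases "totally_bounded (UNIV :: 'a set)")
    case True
    then show ?thesis using W by (rule equi_dominated_totally_bounded[rotated 4])
  next
    case False
    then have im: "integrable_measure \<mu>" and lp: "p \<in> log_exponents \<mu>" using assms(5) by auto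
    obtain C1 where C1: "1 \<le> C1" "\<forall>a d. 0 < d \<longrightarrow> (\<exists>N\<in>null_sets \<mu>. \<forall>x\<in>ball a d - N. \<forall>y\<in>ball a d - N.
      measure \<mu> (ball a d) \<le> 1 \<longrightarrow> measure \<mu> (ball a d) powr (1 / r x - 1 / r y) \<le> C1)"
      using log_exponents_holder[OF pr lp] by blast
    obtain h \<kappa> where h: "h \<in> borel_measurable \<mu>" "\<forall>x. 0 \<le> h x" "(\<integral>\<^sup>+x. ennreal (h x) \<partial>\<mu>) < \<infinity>"
      "0 < \<kappa>" "\<kappa> \<le> 1" "\<forall>x y z c. 0 \<le> z \<longrightarrow> z \<le> 1 \<longrightarrow> z powr r y \<le> c \<longrightarrow> h y \<le> c \<longrightarrow>
      (\<kappa> * z) powr r x \<le> c + h x"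
      using log_exponents_decay[OF pr lp] by blast
    show ?thesis
    proof (rule equi_dominated_integrable[OF W])
      show "(\<integral>\<^sup>+x. 1 / emeasure \<mu> (ball x d) \<partial>\<mu>) < \<infinity>" if "0 < d" for d
        using im that by (simp add: integrable_measure_def)
    qed (use C1 h in auto)
  qed
  have tb: "qn_totally_bounded (L_qnspace \<mu> p) S"
    if "S \<subseteq> Lp_space \<mu> p" "0 \<le> C" "\<And>u. u \<in> S \<Longrightarrow> Lp_norm \<mu> p (eabs u) \<le> ennreal C" "1 \<le> D"
      "\<And>u. u \<in> S \<Longrightarrow> \<exists>g\<in>gradients \<mu> s u. \<forall>k. modular \<mu> p (\<lambda>x. g k x / ennreal ((C + 1) * D)) \<le> 1"
    for S C D
  proof -
    define E where "E = (C + 1) * D"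
    have "(C + 1) * 1 \<le> E" unfolding E_def using that(2,4) by (intro mult_left_mono) auto
    then have E: "C < E" "1 \<le> E" using that(2) by simp_all
    have "Lp_norm \<mu> p (eabs u) < ennreal E" if "u \<in> S" for u
      using \<open>u \<in> S \<Longrightarrow> Lp_norm \<mu> p (eabs u) \<le> ennreal C\<close>[OF that] ennreal_lessI[of E C] E \<open>0 \<le> C\<close>
      by (auto intro: le_less_trans)
    then show ?thesis using \<sigma>(2) that(1,5) E(2) unfolding E_def[symmetric]
      by (intro qn_totally_boundedI[OF pr sr \<sigma>(1) _ dom]) auto
  qed
  have bnd: "\<exists>C\<ge>0. \<forall>u\<in>S. Lp_norm \<mu> p (eabs u) \<le> ennreal C \<and> sn u < ennreal (C + 1)"
    if "\<forall>u\<in>S. Lp_norm \<mu> p (eabs u) + sn u \<le> ennreal C0" for S C0 and sn :: "('a \<Rightarrow> ereal) \<Rightarrow> ennreal"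
  proof (intro exI[of _ "max 0 C0"] conjI ballI)
    fix u assume "u \<in> S"
    then have "Lp_norm \<mu> p (eabs u) + sn u \<le> ennreal C0" using that by blast
    also have "\<dots> \<le> ennreal (max 0 C0)" by (intro ennreal_leI) simp
    finally have le: "Lp_norm \<mu> p (eabs u) + sn u \<le> ennreal (max 0 C0)" .
    show "Lp_norm \<mu> p (eabs u) \<le> ennreal (max 0 C0)" using le by (rule order_trans[rotated]) simp
    have "sn u \<le> ennreal (max 0 C0)" using le by (rule order_trans[rotated]) simp
    also have "\<dots> < ennreal (max 0 C0 + 1)" by (intro ennreal_lessI) auto
    finally show "sn u < ennreal (max 0 C0 + 1)" .
  qed simp
  have "M_qnspace \<mu> s p q \<hookrightarrow>\<hookrightarrow> L_qnspace \<mu> p"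
    unfolding compactly_embedded_def
  proof (intro conjI allI impI)
    show "qn_continuous_inclusion (M_qnspace \<mu> s p q) (L_qnspace \<mu> p)"
      by (intro qn_continuous_inclusionI) (auto simp: M_qnspace_def L_qnspace_def)
    fix S assume S: "qn_bounded (M_qnspace \<mu> s p q) S"
    then obtain C0 where "\<forall>u\<in>S. Lp_norm \<mu> p (eabs u) + M_seminorm \<mu> s p q u \<le> ennreal C0"
      by (auto simp: qn_bounded_def M_qnspace_def)
    from bnd[OF this] obtain C where C: "0 \<le> C"
      "\<And>u. u \<in> S \<Longrightarrow> Lp_norm \<mu> p (eabs u) \<le> ennreal C" "\<And>u. u \<in> S \<Longrightarrow> M_seminorm \<mu> s p q u < ennreal (C + 1)"
      by blast
    show "qn_totally_bounded (L_qnspace \<mu> p) S"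
    proof (rule tb[of S C 1])
      show "S \<subseteq> Lp_space \<mu> p" using S by (auto simp: qn_bounded_def M_qnspace_def)
      show "\<exists>g\<in>gradients \<mu> s u. \<forall>k. modular \<mu> p (\<lambda>x. g k x / ennreal ((C + 1) * 1)) \<le> 1"
        if "u \<in> S" for u
        unfolding mult_1_right using C(3)[OF that] q by (rule M_seminorm_gradient)
    qed (use C in simp_all)
  qed
  moreover have "N_qnspace \<mu> s p q \<hookrightarrow>\<hookrightarrow> L_qnspace \<mu> p"
    unfolding compactly_embedded_def
  proof (intro conjI allI impI)
    show "qn_continuous_inclusion (N_qnspace \<mu> s p q) (L_qnspace \<mu> p)"
      by (intro qn_continuous_inclusionI) (auto simp: N_qnspace_def L_qnspace_def)
    fix S assume S: "qn_bounded (N_qnspace \<mu> s p q) S"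
    then obtain C0 where "\<forall>u\<in>S. Lp_norm \<mu> p (eabs u) + N_seminorm \<mu> s p q u \<le> ennreal C0"
      by (auto simp: qn_bounded_def N_qnspace_def)
    from bnd[OF this] obtain C where C: "0 \<le> C"
      "\<And>u. u \<in> S \<Longrightarrow> Lp_norm \<mu> p (eabs u) \<le> ennreal C" "\<And>u. u \<in> S \<Longrightarrow> N_seminorm \<mu> s p q u < ennreal (C + 1)"
      by blast
    show "qn_totally_bounded (L_qnspace \<mu> p) S"
    proof (rule tb[of S C "2 powr (1 / c)"])
      show "S \<subseteq> Lp_space \<mu> p" using S by (auto simp: qn_bounded_def N_qnspace_def)
      show "1 \<le> 2 powr (1 / c)" using c(1) by (intro ge_one_powr_ge_zero) auto
      show "\<exists>g\<in>gradients \<mu> s u. \<forall>k. modular \<mu> p (\<lambda>x. g k x / ennreal ((C + 1) * 2 powr (1 / c))) \<le> 1"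
        if "u \<in> S" for u
        using C(1) by (intro N_seminorm_gradient[OF C(3)[OF that] _ c]) simp
    qed (use C in simp_all)
  qed
  ultimately show ?thesis ..
qed

end
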